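(* If $\mu_{S_0}$ is stochastically stable, then, as $\varepsilon\to0$, the measure $\mu_{\mathbf V}^\varepsilon:=\mathbf V_{\#}\mu_{\mathbf S}^\varepsilon$ on $U\times\Omega$ converges weakly to $\mu_0\otimes\delta_{\bar0}$, where $\mu_0$ is the physical measure of the unperturbed (classical Lorenz) flow $(\Phi_0^t,t\ge0)$ and $\bar0=(0,0,\dots)\in\Omega$.
   Context: **Fields and flows.** $\phi_0(y)=(-\zeta y_1+\zeta y_2,\,-y_1y_3-\gamma y_1-y_2,\,y_1y_2-\beta y_3-\beta(\gamma+\zeta))$ with $\zeta=10,\gamma=28,\beta=8/3$. $\lambda_\varepsilon$ is a Borel probability measure on $[-1,1]$ with support in $[-\varepsilon,\varepsilon]$, $\lambda_\varepsilon\to\delta_0$ weakly as $\varepsilon\to0$. For each $\eta\in\mathrm{spt}\,\lambda_\varepsilon$ (and $\eta=0$), $\phi_\eta\in C^r(\mathbb R^3,\mathbb R^3)$, $r\ge2$, has flow $(\Phi_\eta^t)$ and lies in a small $C^1$-neighbourhood of $\phi_0$ such that: (i) there is an open $U\subset\mathbb R^3$ independent of $\eta$, with $\Phi_\eta^t(U)\subseteq U$, containing the attractor of $\phi_0$ and $\bigcap_{t\ge0}\Phi_\eta^t(U)$, which is invariant, transitive and contains a hyperbolic singularity; (ii) a fixed compact surface $\mathcal M\subset U$ is a Poincaré section for every $(\Phi_\eta^t)$; (iii) $\mathcal M$ carries an invariant contracting $C^{1+\epsilon}$ stable foliation for each $\eta$, with projection along leaves $q_\eta:\mathcal M\to I_\eta$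 onto a transversal curve. $\Gamma_\eta\subset\mathcal M$ is the leaf of points whose orbit falls into the local stable manifold of the singularity; $\tau_\eta:\mathcal M\setminus\Gamma_\eta\to(0,\infty)$ is the return time, $R_\eta(x)=\Phi_\eta^{\tau_\eta(x)}(x)$. $T_\eta$ is the quotient map ($q_\eta\circ R_\eta=T_\eta\circ q_\eta$). There are $C^1$ diffeomorphisms $\kappa_\eta:\mathcal M\to\mathcal M$, $\iota_\eta:I_\eta\to I:=I_0$ with $\iota_\eta\circ q_\eta=q\circ\kappa_\eta$, $q:=q_0$; $\bar R_\eta=\kappa_\eta R_\eta\kappa_\eta^{-1}$, $\bar T_\eta=\iota_\eta T_\eta\iota_\eta^{-1}$. **Noise.** $\Omega=[-1,1]^{\mathbb Z^+}$ with product topology and Borel $\sigma$-algebra, $\mathbb P_\varepsilon=\lambda_\varepsilon^{\otimes\mathbb Z^+}$, $\theta$ the left shift, $\pi(\omega)$ the first coordinate of $\omega$. **Measures.** $\mathbf T(u,\omega)=(\bar T_{\pi(\omega)}(u),\theta\omega)$ on $I\times\Omega$, $\overline{\mathbf R}(x,\omega)=(\bar R_{\pi(\omega)}(x),\theta\omega)$, $\mathbf R(x,\omega)=(R_{\pi(\omega)}(x),\theta\omega)$ on $\mathcal M\times\Omega$. $\mu_{\mathbf T}^\varepsilon$ is the given $\mathbf T$-invariant probability with marginal $\mathbb P_\varepsilon$ on $\Omega$; $\mu_{\overline{\mathbf R}}^\varepsilon(\psi)=\lim_n\int\mu^\varepsilon_{\mathbf T}(du,d\omega)\inf_{x\in q^{-1}(u)}\psi\circ\overline{\mathbf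 R}^n(x,\omega)$; $\mu_{\mathbf R}^\varepsilon=(\mathbf K^{-1})_\#\mu_{\overline{\mathbf R}}^\varepsilon$ with $\mathbf K(x,\omega)=(\kappa_{\pi(\omega)}(x),\omega)$. Roof function $\mathbf t(x,\omega)=\tau_{\pi(\omega)}(x)$, assumed bounded away from zero and $\mu_{\mathbf R}^\varepsilon$-integrable. $\mathfrak V$ is the suspension space $\{(x,\omega,s):0\le s<\mathbf t(x,\omega)\}$, i.e. the quotient of $\mathcal M\times\Omega\times\mathbb R^+$ identifying $(x,\omega,s+\mathbf t(x,\omega))$ with $(\mathbf R(x,\omega),s)$, with canonical projection $\hat\pi$ and quotient topology. $\mu_{\mathbf S}^\varepsilon(f)=\frac1{\mu_{\mathbf R}^\varepsilon(\mathbf t)}\int\mu_{\mathbf R}^\varepsilon(dx,d\omega)\int_0^{\mathbf t(x,\omega)}f\circ\hat\pi(x,\omega,s)\,ds$. $\mathbf V:\mathfrak V\to U\times\Omega$ is $\mathbf V(x,\omega,s)=(\Phi_{\pi(\omega)}^s(x),\omega)$ for $(x,\omega,s)$ with $0\le s<\mathbf t(x,\omega)$. Unperturbed objects: $\mu_{T_0}$ is the absolutely continuous invariant probability of $T_0$, $\mu_{R_0}(\psi)=\lim_n\int\mu_{T_0}(du)\inf_{x\in q^{-1}(u)}\psi(R_0^n(x))$, $\mu_{S_0}$ is the probability on $\{(x,s):0\le s<\tau_0(x)\}$ given by $\mu_{S_0}(dx,ds)=\mu_{R_0}(\tau_0)^{-1}\mathbf 1_{[0,\tau_0(x)]}(s)\,\mu_{R_0}(dx)\,ds$,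 and $\mu_{\mathbf S_0}=\mu_{S_0}\otimes\delta_{\bar0}$. The physical measure $\mu_0$ is the image of $\mu_{S_0}$ under $(x,s)\mapsto\Phi_0^s(x)$. **Definition.** $\mu_{S_0}$ is *stochastically stable* if $\mu_{\mathbf S}^\varepsilon(f)\to\mu_{\mathbf S_0}(f)=\frac1{\mu_{R_0}(\tau_0)}\int\mu_{R_0}(dx)\int_0^{\tau_0(x)}f\circ\hat\pi(x,\bar0,s)\,ds$ as $\varepsilon\to0$ for every $f\in C_b(\mathfrak V)$.
   Formalization: The formal theorem additionally assumes that φ_η depends continuously on η (C¹ convergence on compact sets), without which the claim fails, and it reads "Poincaré section" as requiring first returns of points off Γ_η to land in the relative interior of M. *)

theory Defs
  imports "HOL-Probability.Probability"
begin

type_synonym vec3 = "real^3"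
type_synonym noise = "nat \<Rightarrow> real"

section \<open>Smooth maps, arcs and surfaces\<close>

primrec Ck_on :: "nat \<Rightarrow> 'a::real_normed_vector set \<Rightarrow> ('a \<Rightarrow> 'b::real_normed_vector) \<Rightarrow> bool" where
  "Ck_on 0 S f \<longleftrightarrow> continuous_on S f"
| "Ck_on (Suc k) S f \<longleftrightarrow> (\<forall>x\<in>S. f differentiable (at x)) \<and>
     (\<forall>v. Ck_on k S (\<lambda>x. frechet_derivative f (at x) v))"

definition C1_Hoelder_on :: "real \<Rightarrow> vec3 set \<Rightarrow> (vec3 \<Rightarrow> vec3) \<Rightarrow> bool" where
  "C1_Hoelder_on \<alpha> S f \<longleftrightarrow> Ck_on 1 S f \<and>
     (\<exists>C. \<forall>x\<in>S. \<forall>y\<in>S. \<forall>v. norm (frechet_derivative f (at x) v - frechet_derivative f (at y) v)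
        \<le> C * dist x y powr \<alpha> * norm v)"

text \<open>Maps between subsets of \<open>\<real>\<^sup>3\<close> (arcs, surfaces) are \<open>C\<^sup>1\<close> if locally they extend to
  \<open>C\<^sup>1\<close> maps on open sets.\<close>

definition C1_map_on :: "vec3 set \<Rightarrow> (vec3 \<Rightarrow> vec3) \<Rightarrow> bool" where
  "C1_map_on A f \<longleftrightarrow>
     (\<forall>x\<in>A. \<exists>W F. open W \<and> x \<in> W \<and> Ck_on 1 W F \<and> (\<forall>y\<in>A \<inter> W. F y = f y))"

definition C1_diffeo :: "vec3 set \<Rightarrow> vec3 set \<Rightarrow> (vec3 \<Rightarrow> vec3) \<Rightarrow> bool" where
  "C1_diffeo A B f \<longleftrightarrow> bij_betw f A B \<and> C1_map_on A f \<and> C1_map_on B (inv_into A f)"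

definition local_coordinates :: "vec3 set \<Rightarrow> (vec3 \<Rightarrow> vec3) \<Rightarrow> bool" where
  "local_coordinates W \<Psi> \<longleftrightarrow> open W \<and> Ck_on 1 W \<Psi> \<and> inj_on \<Psi> W \<and>
     (\<forall>x\<in>W. bij (frechet_derivative \<Psi> (at x)))"

text \<open>A chart at \<open>x\<close> that maps \<open>M\<close> to a plane, half plane or quadrant in \<open>{z. z $ 3 = 0}\<close>, according
  to whether none, one or both of the flags are set. Quadrants are allowed since a cross-section is
  typically a square.\<close>

definition surface_chart :: "vec3 set \<Rightarrow> vec3 \<Rightarrow> vec3 set \<Rightarrow> (vec3 \<Rightarrow> vec3) \<Rightarrow> bool \<Rightarrow> bool \<Rightarrow> bool" where
  "surface_chart M x W \<Psi> b1 b2 \<longleftrightarrow> local_coordinates W \<Psi> \<and> x \<in> W \<and> \<Psi> x = 0 \<and>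
     M \<inter> W = {y\<in>W. \<Psi> y $ 3 = 0 \<and> (b1 \<longrightarrow> \<Psi> y $ 1 \<ge> 0) \<and> (b2 \<longrightarrow> \<Psi> y $ 2 \<ge> 0)}"

definition compact_surface :: "vec3 set \<Rightarrow> bool" where
  "compact_surface M \<longleftrightarrow> compact M \<and> M \<noteq> {} \<and> (\<forall>x\<in>M. \<exists>W \<Psi> b1 b2. surface_chart M x W \<Psi> b1 b2)"

definition surface_interior :: "vec3 set \<Rightarrow> vec3 set" where
  "surface_interior M = {x\<in>M. \<exists>W \<Psi>. surface_chart M x W \<Psi> False False}"

definition transverse :: "(vec3 \<Rightarrow> vec3) \<Rightarrow> vec3 set \<Rightarrow> bool" where
  "transverse X M \<longleftrightarrow> (\<forall>x\<in>M. \<forall>W \<Psi> b1 b2. surface_chart M x W \<Psi> b1 b2 \<longrightarrow>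
     frechet_derivative \<Psi> (at x) (X x) $ 3 \<noteq> 0)"

definition regular_C1_arc :: "(real \<Rightarrow> vec3) \<Rightarrow> bool" where
  "regular_C1_arc \<gamma> \<longleftrightarrow> arc \<gamma> \<and> \<gamma> C1_differentiable_on {0..1} \<and>
     (\<forall>t\<in>{0..1}. vector_derivative \<gamma> (at t) \<noteq> 0)"

definition arclength_measure :: "(real \<Rightarrow> vec3) \<Rightarrow> vec3 measure" where
  "arclength_measure \<gamma> = distr
     (density (restrict_space lborel {0..1}) (\<lambda>t. ennreal (norm (vector_derivative \<gamma> (at t)))))
     (restrict_space borel (path_image \<gamma>)) \<gamma>"


section \<open>Vector fields and flows\<close>

definition lorenz_field :: "vec3 \<Rightarrow> vec3" where
  "lorenz_field y = (let \<zeta> = 10; \<gamma> = 28; \<beta> = 8/3 in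
     vector [- \<zeta> * y$1 + \<zeta> * y$2,
             - y$1 * y$3 - \<gamma> * y$1 - y$2,
             y$1 * y$2 - \<beta> * y$3 - \<beta> * (\<gamma> + \<zeta>)])"

text \<open>Only forward time is used: orbits of the Lorenz field may blow up in backward time.\<close>

definition is_flow :: "(vec3 \<Rightarrow> vec3) \<Rightarrow> (real \<Rightarrow> vec3 \<Rightarrow> vec3) \<Rightarrow> bool" where
  "is_flow X \<Phi> \<longleftrightarrow> (\<forall>x. \<Phi> 0 x = x \<and>
     (\<forall>t\<ge>0. ((\<lambda>s. \<Phi> s x) has_vector_derivative X (\<Phi> t x)) (at t within {0..})))"

text \<open>Continuity of \<open>\<eta> \<mapsto> \<phi> \<eta>\<close> on \<open>E\<close> for the topology of \<open>C\<^sup>1\<close> convergence on compact sets.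
  At \<open>\<eta> = 0\<close> it says that all \<open>\<phi> \<eta>\<close> with \<open>\<bar>\<eta>\<bar> \<le> \<epsilon>\<close> lie in an arbitrarily small
  \<open>C\<^sup>1\<close>-neighbourhood of \<open>\<phi> 0\<close>, if \<open>\<epsilon>\<close> is small; at all of \<open>E\<close> it makes flow, return time
  and return map continuous in the parameter.\<close>

definition C1_continuous_family :: "real set \<Rightarrow> (real \<Rightarrow> vec3 \<Rightarrow> vec3) \<Rightarrow> bool" where
  "C1_continuous_family E \<phi> \<longleftrightarrow> (\<forall>\<eta>\<in>E. \<forall>K d. compact K \<longrightarrow> d > 0 \<longrightarrow>
     (\<exists>\<delta>>0. \<forall>\<eta>'\<in>E. \<bar>\<eta>' - \<eta>\<bar> < \<delta> \<longrightarrow> (\<forall>x\<in>K. norm (\<phi> \<eta>' x - \<phi> \<eta> x) < d \<and>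
        onorm (\<lambda>v. frechet_derivative (\<phi> \<eta>') (at x) v - frechet_derivative (\<phi> \<eta>) (at x) v) < d)))"

definition maximal_invariant :: "(real \<Rightarrow> vec3 \<Rightarrow> vec3) \<Rightarrow> vec3 set \<Rightarrow> vec3 set" where
  "maximal_invariant \<Phi> U = (\<Inter>t\<in>{0..}. \<Phi> t ` U)"

definition flow_invariant :: "(real \<Rightarrow> vec3 \<Rightarrow> vec3) \<Rightarrow> vec3 set \<Rightarrow> bool" where
  "flow_invariant \<Phi> A \<longleftrightarrow> (\<forall>t\<ge>0. \<Phi> t ` A = A)"

definition flow_transitive :: "(real \<Rightarrow> vec3 \<Rightarrow> vec3) \<Rightarrow> vec3 set \<Rightarrow> bool" where
  "flow_transitive \<Phi> A \<longleftrightarrow> (\<exists>x\<in>A. A \<subseteq> closure {\<Phi> t x | t. t \<ge> 0})"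

definition is_attractor :: "(real \<Rightarrow> vec3 \<Rightarrow> vec3) \<Rightarrow> vec3 set \<Rightarrow> bool" where
  "is_attractor \<Phi> A \<longleftrightarrow> compact A \<and> flow_invariant \<Phi> A \<and> flow_transitive \<Phi> A \<and>
     (\<exists>N. open N \<and> A \<subseteq> N \<and> (\<forall>t\<ge>0. \<Phi> t ` N \<subseteq> N) \<and> maximal_invariant \<Phi> N = A)"

definition hyperbolic_singularity :: "(vec3 \<Rightarrow> vec3) \<Rightarrow> vec3 \<Rightarrow> bool" where
  "hyperbolic_singularity X \<sigma> \<longleftrightarrow> X \<sigma> = 0 \<and>
     (\<forall>(l::complex) (v::complex^3). v \<noteq> 0 \<longrightarrow>
        (\<chi> i j. complex_of_real (matrix (frechet_derivative X (at \<sigma>)) $ i $ j)) *v v = l *s v \<longrightarrow>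
        Re l \<noteq> 0)"

definition local_stable_manifold :: "(real \<Rightarrow> vec3 \<Rightarrow> vec3) \<Rightarrow> vec3 \<Rightarrow> real \<Rightarrow> vec3 set" where
  "local_stable_manifold \<Phi> \<sigma> \<rho> =
     {x. (\<forall>t\<ge>0. \<Phi> t x \<in> ball \<sigma> \<rho>) \<and> ((\<lambda>t. \<Phi> t x) \<longlongrightarrow> \<sigma>) at_top}"

text \<open>Points of \<open>M\<close> whose orbit enters the local stable manifold before it meets \<open>M\<close> again. Points
  whose orbit does so after some returns are preimages of these under the return map.\<close>

definition singular_leaf :: "(real \<Rightarrow> vec3 \<Rightarrow> vec3) \<Rightarrow> vec3 set \<Rightarrow> vec3 \<Rightarrow> real \<Rightarrow> vec3 set" where
  "singular_leaf \<Phi> M \<sigma> \<rho> = {x\<in>M. \<exists>t\<ge>0. \<Phi> t x \<in> local_stable_manifold \<Phi> \<sigma> \<rho> \<and>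
     (\<forall>s\<in>{0<..t}. \<Phi> s x \<notin> M)}"

definition return_time :: "(real \<Rightarrow> vec3 \<Rightarrow> vec3) \<Rightarrow> vec3 set \<Rightarrow> vec3 \<Rightarrow> real" where
  "return_time \<Phi> M x = Inf {t. t > 0 \<and> \<Phi> t x \<in> M}"

definition return_map :: "(real \<Rightarrow> vec3 \<Rightarrow> vec3) \<Rightarrow> vec3 set \<Rightarrow> vec3 \<Rightarrow> vec3" where
  "return_map \<Phi> M x = \<Phi> (return_time \<Phi> M x) x"

text \<open>Returns are required to hit the relative interior of \<open>M\<close>: together with transversality this
  makes return time and return map continuous off \<open>\<Gamma>\<close>.\<close>

definition poincare_section ::
    "(vec3 \<Rightarrow> vec3) \<Rightarrow> (real \<Rightarrow> vec3 \<Rightarrow> vec3) \<Rightarrow> vec3 set \<Rightarrow> vec3 set \<Rightarrow> bool" where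
  "poincare_section X \<Phi> M \<Gamma> \<longleftrightarrow> compact_surface M \<and> transverse X M \<and>
     (\<forall>x\<in>M - \<Gamma>. (\<exists>t>0. \<Phi> t x \<in> M) \<and> return_map \<Phi> M x \<in> surface_interior M)"


section \<open>Dynamics of partially defined maps\<close>

text \<open>The maps below are undefined on a singular set. They are represented by a total function \<open>F\<close>
  with a domain \<open>D\<close>; \<open>iter_dom D F n\<close> is the domain of the \<open>n\<close>-th iterate.\<close>

primrec iter_dom :: "'a set \<Rightarrow> ('a \<Rightarrow> 'a) \<Rightarrow> nat \<Rightarrow> 'a set" where
  "iter_dom D F 0 = UNIV"
| "iter_dom D F (Suc n) = {x\<in>D. F x \<in> iter_dom D F n}"

text \<open>Taking \<open>A = space N\<close> shows that \<open>F\<close> is defined almost everywhere if \<open>N\<close> is finite.\<close>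

definition invariant_measure :: "'a measure \<Rightarrow> 'a set \<Rightarrow> ('a \<Rightarrow> 'a) \<Rightarrow> bool" where
  "invariant_measure N D F \<longleftrightarrow> D \<subseteq> space N \<and>
     (\<forall>A\<in>sets N. {x\<in>D. F x \<in> A} \<in> sets N \<and> emeasure N {x\<in>D. F x \<in> A} = emeasure N A)"

text \<open>\<open>N'(\<psi>) = lim\<^sub>n \<integral> N(du) inf {\<psi> (F\<^sup>n x) | x \<in> Q\<^sup>-\<^sup>1(u)}\<close> for all bounded continuous \<open>\<psi>\<close> on \<open>S\<close>.\<close>

definition fibre_inf_lift ::
    "'b measure \<Rightarrow> 'a::topological_space set \<Rightarrow> ('a \<Rightarrow> 'b) \<Rightarrow> 'a set \<Rightarrow> ('a \<Rightarrow> 'a) \<Rightarrow> 'a measure \<Rightarrow> bool" where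
  "fibre_inf_lift N S Q D F N' \<longleftrightarrow>
     prob_space N' \<and> sets N' = sets (restrict_space borel S) \<and>
     (\<forall>\<psi> :: 'a \<Rightarrow> real. continuous_on S \<psi> \<and> bounded (\<psi> ` S) \<longrightarrow>
        (let g = (\<lambda>n u. INF x \<in> {x\<in>S. Q x = u} \<inter> iter_dom D F n. \<psi> ((F ^^ n) x)) in
           (\<forall>n. integrable N (g n)) \<and>
           (\<lambda>n. \<integral>u. g n u \<partial>N) \<longlonglongrightarrow> (\<integral>x. \<psi> x \<partial>N')))"


section \<open>Stable foliation\<close>

text \<open>The leaves are the fibres of \<open>q\<close>, and \<open>q x\<close> is the point where the leaf of \<open>x\<close> meets the
  transversal arc \<open>\<gamma>\<close>. In foliated charts of class \<open>C\<^bsup>1+\<alpha>\<^esup>\<close>, \<open>M\<close> lies in \<open>{z. z $ 3 = 0}\<close> and the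
  leaves are given by \<open>z $ 1 = const\<close>.\<close>

definition stable_foliation ::
    "(vec3 \<Rightarrow> vec3) \<Rightarrow> vec3 set \<Rightarrow> vec3 set \<Rightarrow> (real \<Rightarrow> vec3) \<Rightarrow> (vec3 \<Rightarrow> vec3) \<Rightarrow> bool" where
  "stable_foliation R M \<Gamma> \<gamma> q \<longleftrightarrow>
     regular_C1_arc \<gamma> \<and> path_image \<gamma> \<subseteq> M \<and> q ` M = path_image \<gamma> \<and> (\<forall>u\<in>path_image \<gamma>. q u = u) \<and>
     (\<forall>u\<in>path_image \<gamma>. connected {x\<in>M. q x = u}) \<and>
     (\<exists>\<alpha>>0. \<forall>x\<in>M. \<exists>W \<Psi>. local_coordinates W \<Psi> \<and> C1_Hoelder_on \<alpha> W \<Psi> \<and> x \<in> W \<and>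
        (\<forall>y\<in>M \<inter> W. \<Psi> y $ 3 = 0) \<and>
        (\<forall>y\<in>M \<inter> W. \<forall>z\<in>M \<inter> W. q y = q z \<longleftrightarrow> \<Psi> y $ 1 = \<Psi> z $ 1) \<and>
        (\<forall>t\<in>{0..1}. \<gamma> t \<in> W \<longrightarrow>
           frechet_derivative \<Psi> (at (\<gamma> t)) (vector_derivative \<gamma> (at t)) $ 1 \<noteq> 0)) \<and>
     (\<forall>x\<in>M - \<Gamma>. \<forall>y\<in>M - \<Gamma>. q x = q y \<longrightarrow> q (R x) = q (R y)) \<and>
     (\<exists>C \<rho>. 0 < \<rho> \<and> \<rho> < 1 \<and> (\<forall>n. \<forall>x\<in>M. \<forall>y\<in>M. q x = q y \<longrightarrow>
        x \<in> iter_dom (M - \<Gamma>) R n \<longrightarrow> y \<in> iter_dom (M - \<Gamma>) R n \<longrightarrow>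
        dist ((R ^^ n) x) ((R ^^ n) y) \<le> C * \<rho> ^ n * dist x y))"


section \<open>Noise\<close>

definition seqs :: "real set \<Rightarrow> noise set" where
  "seqs E = {\<omega>. \<forall>n. \<omega> n \<in> E}"

abbreviation \<Omega> :: "noise set" where
  "\<Omega> \<equiv> seqs {-1..1}"

definition zero_noise :: noise where
  "zero_noise = (\<lambda>n. 0)"

definition noise_shift :: "noise \<Rightarrow> noise" where
  "noise_shift \<omega> = (\<lambda>n. \<omega> (Suc n))"

definition measure_support :: "real measure \<Rightarrow> real set" where
  "measure_support N = {x. \<forall>W. open W \<and> x \<in> W \<longrightarrow> emeasure N W > 0}"

definition skew :: "(real \<Rightarrow> 'a \<Rightarrow> 'a) \<Rightarrow> 'a \<times> noise \<Rightarrow> 'a \<times> noise" where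
  "skew F = (\<lambda>(x, \<omega>). (F (\<omega> 0) x, noise_shift \<omega>))"

text \<open>\<open>skew F\<close> is defined at \<open>(x, \<omega>)\<close> if \<open>x\<close> is not in the singular set of \<open>F (\<omega> 0)\<close>.\<close>

definition skew_dom :: "'a set \<Rightarrow> real set \<Rightarrow> (real \<Rightarrow> 'a set) \<Rightarrow> ('a \<times> noise) set" where
  "skew_dom A E Z = {(x, \<omega>). x \<in> A \<and> \<omega> \<in> seqs E \<and> x \<notin> Z (\<omega> 0)}"


section \<open>Weak convergence and quotient topology\<close>

definition borel_of :: "'a topology \<Rightarrow> 'a measure" where
  "borel_of X = sigma (topspace X) {W. openin X W}"

definition bounded_continuous :: "'a topology \<Rightarrow> ('a \<Rightarrow> real) \<Rightarrow> bool" where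
  "bounded_continuous X f \<longleftrightarrow> continuous_map X euclideanreal f \<and> bounded (f ` topspace X)"

definition weak_limit :: "'a topology \<Rightarrow> ('b \<Rightarrow> 'a measure) \<Rightarrow> 'a measure \<Rightarrow> 'b filter \<Rightarrow> bool" where
  "weak_limit X N N' F \<longleftrightarrow>
     (\<forall>f. bounded_continuous X f \<longrightarrow> ((\<lambda>i. \<integral>x. f x \<partial>N i) \<longlongrightarrow> (\<integral>x. f x \<partial>N')) F)"

definition quotient_topology :: "'a topology \<Rightarrow> ('a \<Rightarrow> 'b) \<Rightarrow> 'b topology" where
  "quotient_topology X p =
     topology (\<lambda>S. S \<subseteq> p ` topspace X \<and> openin X {x \<in> topspace X. p x \<in> S})"

lemma openin_quotient_topology:
  "openin (quotient_topology X p) S \<longleftrightarrow>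
     S \<subseteq> p ` topspace X \<and> openin X {x \<in> topspace X. p x \<in> S}"
proof -
  have "istopology (\<lambda>S. S \<subseteq> p ` topspace X \<and> openin X {x \<in> topspace X. p x \<in> S})"
    unfolding istopology_def
  proof (intro conjI allI impI)
    fix S T assume *: "S \<subseteq> p ` topspace X \<and> openin X {x \<in> topspace X. p x \<in> S}"
      "T \<subseteq> p ` topspace X \<and> openin X {x \<in> topspace X. p x \<in> T}"
    have "{x \<in> topspace X. p x \<in> S \<inter> T} = {x \<in> topspace X. p x \<in> S} \<inter> {x \<in> topspace X. p x \<in> T}"
      by auto
    then show "openin X {x \<in> topspace X. p x \<in> S \<inter> T}"
      using * by (simp add: openin_Int)
    show "S \<inter> T \<subseteq> p ` topspace X"
      using * by auto
  next
    fix \<K> assume *: "\<forall>K\<in>\<K>. K \<subseteq> p ` topspace X \<and> openin X {x \<in> topspace X. p x \<in> K}"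
    have "{x \<in> topspace X. p x \<in> \<Union>\<K>} = (\<Union>K\<in>\<K>. {x \<in> topspace X. p x \<in> K})"
      by auto
    then show "openin X {x \<in> topspace X. p x \<in> \<Union>\<K>}"
      using * by (auto intro: openin_Union)
    show "\<Union>\<K> \<subseteq> p ` topspace X"
      using * by auto
  qed
  then show ?thesis
    by (simp add: quotient_topology_def topology_inverse')
qed

lemma topspace_quotient_topology: "topspace (quotient_topology X p) = p ` topspace X"
proof -
  have "{x \<in> topspace X. p x \<in> p ` topspace X} = topspace X"
    by auto
  then have "openin (quotient_topology X p) (p ` topspace X)"
    by (simp add: openin_quotient_topology)
  then have "p ` topspace X \<subseteq> topspace (quotient_topology X p)"
    by (rule openin_subset)
  moreover have "topspace (quotient_topology X p) \<subseteq> p ` topspace X"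
    using iffD1[OF openin_quotient_topology openin_topspace] by (rule conjunct1)
  ultimately show ?thesis
    by (intro subset_antisym)
qed

lemma quotient_map_quotient_topology: "quotient_map X (quotient_topology X p) p"
  by (simp add: quotient_map_def topspace_quotient_topology openin_quotient_topology)


section \<open>Suspensions\<close>

text \<open>\<open>F\<close> is a map on \<open>B\<close> with domain \<open>D \<subseteq> B\<close> and roof function \<open>\<tau>\<close> on \<open>D\<close>. The roof is infinite
  outside \<open>D\<close>: nothing is identified above points that do not return. The quotient is realised on the
  set of representatives \<open>(p, s)\<close> with \<open>0 \<le> s < \<tau> p\<close>.\<close>

definition susp_cover :: "'p set \<Rightarrow> ('p \<times> real) set" where
  "susp_cover B = B \<times> {0..}"

definition susp_step :: "'p set \<Rightarrow> ('p \<Rightarrow> real) \<Rightarrow> ('p \<Rightarrow> 'p) \<Rightarrow> 'p \<times> real \<Rightarrow> 'p \<times> real \<Rightarrow> bool" where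
  "susp_step D \<tau> F z z' \<longleftrightarrow> (\<exists>p\<in>D. \<exists>s\<ge>0. z = (p, s + \<tau> p) \<and> z' = (F p, s))"

definition susp_space :: "'p set \<Rightarrow> 'p set \<Rightarrow> ('p \<Rightarrow> real) \<Rightarrow> ('p \<times> real) set" where
  "susp_space B D \<tau> = {(p, s) \<in> susp_cover B. p \<in> D \<longrightarrow> s < \<tau> p}"

definition susp_proj ::
    "'p set \<Rightarrow> 'p set \<Rightarrow> ('p \<Rightarrow> real) \<Rightarrow> ('p \<Rightarrow> 'p) \<Rightarrow> 'p \<times> real \<Rightarrow> 'p \<times> real" where
  "susp_proj B D \<tau> F z = (THE z'. z' \<in> susp_space B D \<tau> \<and> equivclp (susp_step D \<tau> F) z z')"

definition susp_topology ::
    "'p::topological_space set \<Rightarrow> 'p set \<Rightarrow> ('p \<Rightarrow> real) \<Rightarrow> ('p \<Rightarrow> 'p) \<Rightarrow> ('p \<times> real) topology" where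
  "susp_topology B D \<tau> F = quotient_topology (top_of_set (susp_cover B)) (susp_proj B D \<tau> F)"

definition susp_measure :: "'p measure \<Rightarrow> ('p \<Rightarrow> real) \<Rightarrow> ('p \<times> real) measure" where
  "susp_measure N \<tau> = density (N \<Otimes>\<^sub>M restrict_space lborel {0..})
     (\<lambda>(p, s). ennreal (indicator {0..<\<tau> p} s / (\<integral>p. \<tau> p \<partial>N)))"


section \<open>The random flow\<close>

text \<open>\<open>E\<close> is the set of parameters for which the fields are given, so the random objects live on
  \<open>M \<times> seqs E\<close>; for \<open>E = {-1..1}\<close> this is \<open>M \<times> \<Omega>\<close>.\<close>

definition roof :: "(real \<Rightarrow> real \<Rightarrow> vec3 \<Rightarrow> vec3) \<Rightarrow> vec3 set \<Rightarrow> vec3 \<times> noise \<Rightarrow> real" where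
  "roof \<Phi> M = (\<lambda>(x, \<omega>). return_time (\<Phi> (\<omega> 0)) M x)"

definition rand_R :: "(real \<Rightarrow> real \<Rightarrow> vec3 \<Rightarrow> vec3) \<Rightarrow> vec3 set \<Rightarrow> vec3 \<times> noise \<Rightarrow> vec3 \<times> noise" where
  "rand_R \<Phi> M = skew (\<lambda>\<eta>. return_map (\<Phi> \<eta>) M)"

definition \<VV>_proj :: "(real \<Rightarrow> real \<Rightarrow> vec3 \<Rightarrow> vec3) \<Rightarrow> vec3 set \<Rightarrow> real set \<Rightarrow> (real \<Rightarrow> vec3 set)
    \<Rightarrow> (vec3 \<times> noise) \<times> real \<Rightarrow> (vec3 \<times> noise) \<times> real" where
  "\<VV>_proj \<Phi> M E \<Gamma> = susp_proj (M \<times> seqs E) (skew_dom M E \<Gamma>) (roof \<Phi> M) (rand_R \<Phi> M)"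

definition \<VV>_topology :: "(real \<Rightarrow> real \<Rightarrow> vec3 \<Rightarrow> vec3) \<Rightarrow> vec3 set \<Rightarrow> real set \<Rightarrow> (real \<Rightarrow> vec3 set)
    \<Rightarrow> ((vec3 \<times> noise) \<times> real) topology" where
  "\<VV>_topology \<Phi> M E \<Gamma> = susp_topology (M \<times> seqs E) (skew_dom M E \<Gamma>) (roof \<Phi> M) (rand_R \<Phi> M)"

definition rand_K :: "(real \<Rightarrow> vec3 \<Rightarrow> vec3) \<Rightarrow> vec3 \<times> noise \<Rightarrow> vec3 \<times> noise" where
  "rand_K \<kappa> = (\<lambda>(x, \<omega>). (\<kappa> (\<omega> 0) x, \<omega>))"

definition rand_V :: "(real \<Rightarrow> real \<Rightarrow> vec3 \<Rightarrow> vec3) \<Rightarrow> (vec3 \<times> noise) \<times> real \<Rightarrow> vec3 \<times> noise" where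
  "rand_V \<Phi> = (\<lambda>((x, \<omega>), s). (\<Phi> (\<omega> 0) s x, \<omega>))"

definition stochastically_stable :: "(real \<Rightarrow> real \<Rightarrow> vec3 \<Rightarrow> vec3) \<Rightarrow> vec3 set \<Rightarrow> real set
    \<Rightarrow> (real \<Rightarrow> vec3 set) \<Rightarrow> (real \<Rightarrow> ((vec3 \<times> noise) \<times> real) measure) \<Rightarrow> vec3 measure \<Rightarrow> bool" where
  "stochastically_stable \<Phi> M E \<Gamma> \<mu>S \<mu>R0 \<longleftrightarrow>
     (let \<tau>0 = return_time (\<Phi> 0) M in
      \<forall>f. bounded_continuous (\<VV>_topology \<Phi> M E \<Gamma>) f \<longrightarrow>
        ((\<lambda>\<epsilon>. \<integral>z. f z \<partial>\<mu>S \<epsilon>) \<longlongrightarrow>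
          (1 / (\<integral>x. \<tau>0 x \<partial>\<mu>R0)) *
          (\<integral>x. (LINT s:{0..\<tau>0 x}|lborel. f (\<VV>_proj \<Phi> M E \<Gamma> ((x, zero_noise), s))) \<partial>\<mu>R0))
        (at_right 0))"

end

theory Submission
  imports Defs
begin

text \<open>
  The image measures would converge by the continuous mapping principle if \<open>rand_V \<Phi>\<close> were
  continuous on the suspension. It is not: a point of the suspension remembers the noise sequence of
  its current excursion, and when the orbit returns to the section the sequence \<open>\<omega>\<close> jumps to its
  shift, while the position in \<open>\<real>\<^sup>3\<close> moves on continuously. The jump is confined to the image of the
  section, which is a null set for the unperturbed suspension measure. So for a bounded continuous
  \<open>f\<close> the function \<open>f \<circ> rand_V \<Phi>\<close> is replaced by one that passes from \<open>f (y, \<omega>)\<close> to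
  \<open>f (y, noise_shift \<omega>)\<close> continuously in a thin layer below the roof (\<open>blend\<close>). The error is
  at most a multiple of a function \<open>gap\<close> that is itself continuous on the suspension and
  concentrated near the section. Stochastic stability applies to both, and hence
  bounds the error uniformly in small \<open>\<epsilon>\<close> (\<open>weak_limit_of_flow\<close>, \<open>tendsto_if_approximable\<close>).

  That these functions are continuous for the quotient topology needs two ingredients.

  The first is the suspension itself (\<open>continuous_map_susp_topology\<close>): a continuous function below
  the roof whose values at the roof agree with those at the return points descends to a
  continuous function, provided that the roof is bounded below, and that its reciprocal, extended
  by 0 to the points without return, is continuous.

  The second is continuity of this reciprocal, jointly in parameter and starting point
  (\<open>continuous_on_return_rate\<close>). It rests on the continuous dependence of the flow on parameter and initial
  value, a Gronwall estimate (\<open>solutions_close\<close>). A return does not disappear under small changes because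
  the section is crossed transversally at an interior point (\<open>eventually_return_before\<close>), and no
  earlier return can appear because the section is compact and returns take at least a fixed time
  (\<open>eventually_no_early_return\<close>). The latter also covers orbits that fall into the singularity, near
  which return times blow up.
\<close>


section \<open>Functions on a suspension\<close>

text \<open>\<open>D\<close> is the set of points that return. Continuity of the reciprocal roof, with value 0 off
  \<open>D\<close>, says that \<open>D\<close> is open in \<open>B\<close>, that \<open>\<tau>\<close> is continuous on \<open>D\<close>, and that \<open>\<tau>\<close> tends to infinity
  at the points without return, in agreement with the infinite roof there.\<close>

locale suspension =
  fixes B D :: "'p::topological_space set" and \<tau> :: "'p \<Rightarrow> real" and F :: "'p \<Rightarrow> 'p" and c :: real
  assumes D_subset: "D \<subseteq> B"
    and F_into: "p \<in> D \<Longrightarrow> F p \<in> B"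
    and c_pos: "0 < c"
    and roof_ge: "p \<in> D \<Longrightarrow> c \<le> \<tau> p"
    and continuous_F: "continuous_on D F"
    and continuous_rate: "continuous_on B (\<lambda>p. if p \<in> D then inverse (\<tau> p) else 0)"
begin

definition rate :: "'p \<Rightarrow> real" where
  "rate p = (if p \<in> D then inverse (\<tau> p) else 0)"

lemma continuous_on_rate: "continuous_on B rate"
  using continuous_rate unfolding rate_def[abs_def] .

lemma rate_pos_iff: "0 < rate p \<longleftrightarrow> p \<in> D"
  using roof_ge[of p] c_pos by (auto simp: rate_def)

lemma level_ge_1_iff: "1 \<le> s * rate p \<longleftrightarrow> p \<in> D \<and> \<tau> p \<le> s"
  using roof_ge[of p] c_pos by (auto simp: rate_def field_simps)

lemma level_less_1_iff: "s * rate p < 1 \<longleftrightarrow> (p \<in> D \<longrightarrow> s < \<tau> p)"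
  using level_ge_1_iff[of s p] by auto

lemma level_at_roof: "p \<in> D \<Longrightarrow> \<tau> p * rate p = 1"
  using roof_ge[of p] c_pos by (auto simp: rate_def)

lemma mem_susp_space_iff:
  "(p, s) \<in> susp_space B D \<tau> \<longleftrightarrow> p \<in> B \<and> 0 \<le> s \<and> s * rate p < 1"
  by (auto simp: susp_space_def susp_cover_def level_less_1_iff)

lemma continuous_on_roof: "continuous_on D \<tau>"
proof -
  have "continuous_on D (\<lambda>p. inverse (rate p))"
    using continuous_on_subset[OF continuous_on_rate D_subset] rate_pos_iff
    by (intro continuous_on_inverse) (simp_all, metis less_irrefl)
  then show ?thesis
    by (rule continuous_on_eq) (auto simp: rate_def)
qed

lemma step_deterministic:
  "susp_step D \<tau> F z z' \<Longrightarrow> susp_step D \<tau> F z z'' \<Longrightarrow> z' = z''"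
  by (auto simp: susp_step_def)

lemma no_step_from_susp_space: "z \<in> susp_space B D \<tau> \<Longrightarrow> \<not> susp_step D \<tau> F z z'"
  by (auto simp: susp_step_def susp_space_def)

text \<open>The identification moves deterministically towards the representative, so a point
  identified with a representative is also driven to it by forward steps.\<close>

lemma equivclp_representative:
  assumes "equivclp (susp_step D \<tau> F) n z" "n \<in> susp_space B D \<tau>"
  shows "(susp_step D \<tau> F)\<^sup>*\<^sup>* z n"
  using assms(1)
proof (induction rule: equivclp_induct)
  case base
  then show ?case by simp
next
  case (step y z)
  from step(2) show ?case
  proof
    assume yz: "susp_step D \<tau> F y z"
    from step(3) show ?thesis
    proof (cases rule: converse_rtranclpE)
      case base
      then show ?thesis
        using no_step_from_susp_space[OF assms(2)] yz by auto
    next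
      case (step y')
      then show ?thesis
        using step_deterministic[OF yz step(1)] by simp
    qed
  next
    assume "susp_step D \<tau> F z y"
    then show ?thesis
      using step(3) by (rule converse_rtranclp_into_rtranclp)
  qed
qed

lemma representative_unique:
  assumes "equivclp (susp_step D \<tau> F) z n" "n \<in> susp_space B D \<tau>"
    and "equivclp (susp_step D \<tau> F) z n'" "n' \<in> susp_space B D \<tau>"
  shows "n = n'"
proof -
  have "equivclp (susp_step D \<tau> F) n n'"
    using assms(1,3) by (meson equivclp_sym equivclp_trans)
  then have "(susp_step D \<tau> F)\<^sup>*\<^sup>* n' n"
    using equivclp_representative assms(2) by blast
  then show ?thesis
    by (cases rule: converse_rtranclpE) (use no_step_from_susp_space[OF assms(4)] in auto)
qed

lemma susp_proj_eqI:
  assumes "n \<in> susp_space B D \<tau>" "equivclp (susp_step D \<tau> F) z n"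
  shows "susp_proj B D \<tau> F z = n"
  unfolding susp_proj_def using assms representative_unique by (intro the_equality) blast+

lemma susp_proj_representative: "z \<in> susp_space B D \<tau> \<Longrightarrow> susp_proj B D \<tau> F z = z"
  by (rule susp_proj_eqI) auto

lemma susp_proj_above_roof:
  assumes "p \<in> D" "\<tau> p \<le> s"
  shows "susp_proj B D \<tau> F (p, s) = susp_proj B D \<tau> F (F p, s - \<tau> p)"
proof -
  have "susp_step D \<tau> F (p, s) (F p, s - \<tau> p)"
    unfolding susp_step_def using assms by (intro bexI[of _ p] exI[of _ "s - \<tau> p"]) auto
  then have "equivclp (susp_step D \<tau> F) (p, s) z' \<longleftrightarrow>
      equivclp (susp_step D \<tau> F) (F p, s - \<tau> p) z'" for z'
    by (meson equivclp_sym equivclp_trans r_into_equivclp)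
  then show ?thesis
    by (simp add: susp_proj_def)
qed

text \<open>The roof is at least \<^term>\<open>c\<close>, so a point below height \<^term>\<open>real n * c\<close> reaches its
  representative in at most \<^term>\<open>n\<close> steps.\<close>

lemma susp_proj_in_susp_space:
  assumes "p \<in> B" "0 \<le> s" "s \<le> real n * c"
  shows "susp_proj B D \<tau> F (p, s) \<in> susp_space B D \<tau>"
  using assms
proof (induction n arbitrary: p s)
  case 0
  then have "(p, s) \<in> susp_space B D \<tau>"
    by (simp add: mem_susp_space_iff)
  then show ?case by (simp add: susp_proj_representative)
next
  case (Suc n)
  show ?case
  proof (cases "p \<in> D \<and> \<tau> p \<le> s")
    case True
    then have "susp_proj B D \<tau> F (F p, s - \<tau> p) \<in> susp_space B D \<tau>"
      using Suc.prems roof_ge[of p] F_into[of p]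
      by (intro Suc.IH) (auto simp: algebra_simps)
    then show ?thesis
      using True susp_proj_above_roof[of p s] by simp
  next
    case False
    then have "(p, s) \<in> susp_space B D \<tau>"
      using Suc.prems level_ge_1_iff[of s p] by (auto simp: mem_susp_space_iff)
    then show ?thesis
      by (simp add: susp_proj_representative)
  qed
qed

lemma topspace_susp_topology: "topspace (susp_topology B D \<tau> F) = susp_space B D \<tau>"
proof -
  have "susp_proj B D \<tau> F ` susp_cover B = susp_space B D \<tau>"
  proof (intro subset_antisym subsetI)
    fix z assume "z \<in> susp_proj B D \<tau> F ` susp_cover B"
    then obtain p s where z: "p \<in> B" "0 \<le> s" "z = susp_proj B D \<tau> F (p, s)"
      by (auto simp: susp_cover_def)
    obtain n where "s \<le> real n * c"
      using reals_Archimedean3[OF c_pos] by (meson less_imp_le)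
    then show "z \<in> susp_space B D \<tau>"
      using z susp_proj_in_susp_space by blast
  next
    fix z assume "z \<in> susp_space B D \<tau>"
    then show "z \<in> susp_proj B D \<tau> F ` susp_cover B"
      using susp_proj_representative[of z] by (intro image_eqI[of _ _ z]) (auto simp: susp_space_def)
  qed
  then show ?thesis
    by (simp add: susp_topology_def topspace_quotient_topology)
qed

text \<open>The only point at or below the roof that is not its own representative is the one at the
  roof; there the gluing condition applies.\<close>

lemma glued_value:
  fixes G :: "'p \<times> real \<Rightarrow> 'a"
  assumes glue: "\<And>p. p \<in> D \<Longrightarrow> G (p, \<tau> p) = G (F p, 0)"
    and "p \<in> B" "0 \<le> s" and le: "p \<in> D \<Longrightarrow> s \<le> \<tau> p"
  shows "G (susp_proj B D \<tau> F (p, s)) = G (p, s)"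
proof (cases "p \<in> D \<and> s = \<tau> p")
  case True
  then have "susp_proj B D \<tau> F (p, s) = susp_proj B D \<tau> F (F p, 0)"
    using susp_proj_above_roof[of p s] by simp
  also have "\<dots> = (F p, 0)"
    using F_into[of p] True by (intro susp_proj_representative) (simp add: mem_susp_space_iff)
  finally show ?thesis
    using glue[of p] True by simp
next
  case False
  then have "(p, s) \<in> susp_space B D \<tau>"
    using assms(2-4) by (auto simp: mem_susp_space_iff level_less_1_iff)
  then show ?thesis
    by (simp add: susp_proj_representative)
qed

text \<open>A function on the part below the roof descends to a continuous function on the suspension as
  soon as its values at the roof match those at the bottom. On the cover, the strip of height
  \<^term>\<open>real (Suc n) * c\<close> is the union of the closed pieces below and above the roof; the upper one
  is mapped continuously into the strip of height \<^term>\<open>real n * c\<close>. That these pieces are closed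
  is where continuity of \<^term>\<open>rate\<close> also at points without return is needed.\<close>

lemma continuous_on_cover_strip:
  fixes G :: "'p \<times> real \<Rightarrow> real"
  assumes G: "continuous_on (B \<times> {0..}) G"
    and glue: "\<And>p. p \<in> D \<Longrightarrow> G (p, \<tau> p) = G (F p, 0)"
  shows "continuous_on (B \<times> {0..real n * c}) (\<lambda>z. G (susp_proj B D \<tau> F z))"
proof (induction n)
  case 0
  have "susp_proj B D \<tau> F z = z" if "z \<in> B \<times> {0..real 0 * c}" for z
    using that by (intro susp_proj_representative) (auto simp: mem_susp_space_iff)
  moreover have "continuous_on (B \<times> {0..real 0 * c}) G"
    by (rule continuous_on_subset[OF G]) auto
  ultimately show ?case
    by (auto cong: continuous_on_cong_simp simp del: mult_eq_0_iff intro: continuous_on_eq)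
next
  case (Suc n)
  let ?\<pi> = "susp_proj B D \<tau> F"
  let ?S = "B \<times> {0..real (Suc n) * c}"
  let ?low = "{z \<in> ?S. snd z * rate (fst z) \<in> {..1}}"
  let ?high = "{z \<in> ?S. snd z * rate (fst z) \<in> {1..}}"
  have level: "continuous_on ?S (\<lambda>z. snd z * rate (fst z))"
    by (intro continuous_intros continuous_on_compose2[OF continuous_on_rate]) auto
  have cl: "closedin (top_of_set ?S) ?low" "closedin (top_of_set ?S) ?high"
    using continuous_closedin_preimage[OF level, of "{..1}"]
      continuous_closedin_preimage[OF level, of "{1..}"] by (auto simp: vimage_def Int_def)
  have low: "G z = G (?\<pi> z)" if z: "z \<in> ?low" for z
  proof -
    obtain p s where ps: "z = (p, s)" by force
    have "s \<le> \<tau> p" if "p \<in> D"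
    proof -
      have "s * rate p \<le> \<tau> p * rate p"
        using z ps level_at_roof[OF that] by auto
      then show ?thesis
        using that rate_pos_iff[of p] mult_le_cancel_right_pos by blast
    qed
    then show ?thesis
      using glued_value[of G p s, OF glue] z ps by auto
  qed
  have "continuous_on ?low G"
    by (rule continuous_on_subset[OF G]) auto
  then have 1: "continuous_on ?low (\<lambda>z. G (?\<pi> z))"
    by (rule continuous_on_eq) (rule low)
  have high: "fst z \<in> D \<and> \<tau> (fst z) \<le> snd z" if "z \<in> ?high" for z
    using that level_ge_1_iff[of "snd z" "fst z"] by auto
  have "continuous_on ?high (\<lambda>z. (F (fst z), snd z - \<tau> (fst z)))"
    by (intro continuous_intros continuous_on_compose2[OF continuous_F]
        continuous_on_compose2[OF continuous_on_roof]) (use high in auto)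
  moreover have "(\<lambda>z. (F (fst z), snd z - \<tau> (fst z))) ` ?high \<subseteq> B \<times> {0..real n * c}"
  proof (rule image_subsetI)
    fix z assume z: "z \<in> ?high"
    have "snd z \<le> real n * c + c"
      using z by (auto simp: algebra_simps)
    then show "(F (fst z), snd z - \<tau> (fst z)) \<in> B \<times> {0..real n * c}"
      using high[OF z] F_into[of "fst z"] roof_ge[of "fst z"] by auto
  qed
  ultimately have "continuous_on ?high (\<lambda>z. G (?\<pi> (F (fst z), snd z - \<tau> (fst z))))"
    by (rule continuous_on_compose2[OF Suc.IH])
  then have 2: "continuous_on ?high (\<lambda>z. G (?\<pi> z))"
  proof (rule continuous_on_eq)
    fix z assume "z \<in> ?high"
    then show "G (?\<pi> (F (fst z), snd z - \<tau> (fst z))) = G (?\<pi> z)"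
      using high[of z] susp_proj_above_roof[of "fst z" "snd z"] by simp
  qed
  have un: "?low \<union> ?high = ?S"
    by auto
  show ?case
    using continuous_on_Un_local[of ?low ?high "\<lambda>z. G (?\<pi> z)"] cl 1 2 unfolding un by blast
qed

lemma continuous_map_susp_topology:
  fixes G :: "'p \<times> real \<Rightarrow> real"
  assumes G: "continuous_on (B \<times> {0..}) G"
    and glue: "\<And>p. p \<in> D \<Longrightarrow> G (p, \<tau> p) = G (F p, 0)"
  shows "continuous_map (susp_topology B D \<tau> F) euclideanreal G"
proof -
  let ?H = "\<lambda>z. G (susp_proj B D \<tau> F z)"
  have "(?H \<longlongrightarrow> ?H z) (at z within susp_cover B)" if z: "z \<in> susp_cover B" for z
  proof -
    obtain n where n: "snd z < real n * c"
      using reals_Archimedean3[OF c_pos] by blast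
    let ?O = "UNIV \<times> {..<real n * c}"
    have "continuous_on (susp_cover B \<inter> ?O) ?H"
      by (rule continuous_on_subset[OF continuous_on_cover_strip[OF G glue, of n]])
        (auto simp: susp_cover_def)
    moreover have "z \<in> ?O" "open ?O"
      using n by (auto simp: open_Times mem_Times_iff)
    ultimately have "(?H \<longlongrightarrow> ?H z) (at z within susp_cover B \<inter> ?O)"
      using z by (auto simp: continuous_on_def)
    moreover have "at z within susp_cover B \<inter> ?O = at z within susp_cover B"
      using \<open>z \<in> ?O\<close> \<open>open ?O\<close> by (intro at_within_nhd[where S = ?O]) auto
    ultimately show ?thesis
      by simp
  qed
  then have "continuous_on (susp_cover B) ?H"
    by (simp add: continuous_on_def)
  then have "continuous_map (top_of_set (susp_cover B)) euclideanreal (G \<circ> susp_proj B D \<tau> F)"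
    by (simp add: o_def)
  then show ?thesis
    unfolding susp_topology_def
    by (rule continuous_compose_quotient_map[OF quotient_map_quotient_topology])
qed

end

section \<open>Flows that depend continuously on a parameter\<close>

lemma Gronwall_affine:
  fixes u :: "real \<Rightarrow> real"
  assumes "0 \<le> t" and cont: "continuous_on {0..t} u"
    and der: "\<And>s. 0 < s \<Longrightarrow> s < t \<Longrightarrow> (u has_real_derivative u' s) (at s)"
    and le: "\<And>s. 0 < s \<Longrightarrow> s < t \<Longrightarrow> u' s \<le> a * (u s + b)"
  shows "u t + b \<le> exp (a * t) * (u 0 + b)"
proof -
  let ?v = "\<lambda>s. exp (- (a * s)) * (u s + b)"
  have "?v t \<le> ?v 0"
  proof (rule DERIV_nonpos_imp_decreasing_open[OF \<open>0 \<le> t\<close>])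
    fix s assume s: "0 < s" "s < t"
    have "(?v has_real_derivative exp (- (a * s)) * (u' s - a * (u s + b))) (at s)"
      using der[OF s] by (auto intro!: derivative_eq_intros simp: algebra_simps)
    moreover have "exp (- (a * s)) * (u' s - a * (u s + b)) \<le> 0"
      using le[OF s] by (intro mult_nonneg_nonpos) auto
    ultimately show "\<exists>y. (?v has_real_derivative y) (at s) \<and> y \<le> 0"
      by blast
  next
    show "continuous_on {0..t} ?v"
      by (intro continuous_intros cont)
  qed
  then have "exp (- (a * t)) * (u t + b) \<le> u 0 + b"
    by simp
  then have "exp (a * t) * (exp (- (a * t)) * (u t + b)) \<le> exp (a * t) * (u 0 + b)"
    by (intro mult_left_mono) auto
  then show ?thesis
    by (simp add: mult.assoc[symmetric] exp_minus)
qed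

text \<open>Gronwall for the squared distance \<open>u\<close>: where both orbits are in the ball,
  \<open>u' \<le> 2 \<surd>u (d + L \<surd>u) \<le> (2 L + 1) (u + d\<^sup>2)\<close>. The bound on \<open>u\<close> at the final time keeps
  the second orbit within distance 1 of the first, hence in the ball: otherwise apply the estimate up
  to the first time at which \<open>u \<ge> 1\<close>.\<close>

lemma solutions_close:
  fixes X Y :: "'a::real_inner \<Rightarrow> 'a" and y z :: "real \<Rightarrow> 'a"
  assumes "0 \<le> L" "0 \<le> T"
    and z: "\<And>t. 0 \<le> t \<Longrightarrow> (z has_vector_derivative X (z t)) (at t within {0..})"
    and y: "\<And>t. 0 \<le> t \<Longrightarrow> (y has_vector_derivative Y (y t)) (at t within {0..})"
    and bound: "\<And>t. t \<in> {0..T} \<Longrightarrow> norm (z t) \<le> r"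
    and Lip: "\<And>a b. norm a \<le> r + 1 \<Longrightarrow> norm b \<le> r + 1 \<Longrightarrow> norm (X a - X b) \<le> L * norm (a - b)"
    and close: "\<And>a. norm a \<le> r + 1 \<Longrightarrow> norm (Y a - X a) \<le> d"
    and small: "exp ((2 * L + 1) * T) * ((norm (y 0 - z 0))\<^sup>2 + d\<^sup>2) < 1"
    and t: "t \<in> {0..T}"
  shows "(norm (y t - z t))\<^sup>2 \<le> exp ((2 * L + 1) * T) * ((norm (y 0 - z 0))\<^sup>2 + d\<^sup>2)"
proof -
  define u where "u = (\<lambda>s. (norm (y s - z s))\<^sup>2)"
  define C where "C = exp ((2 * L + 1) * T) * (u 0 + d\<^sup>2)"
  have cy: "continuous_on {0..} y" and cz: "continuous_on {0..} z"
    using z y by (auto simp: continuous_on_eq_continuous_within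
        dest!: has_vector_derivative_continuous)
  then have cu: "continuous_on {0..} u"
    unfolding u_def by (intro continuous_intros)
  have est: "u t \<le> C" if t: "0 \<le> t" "t \<le> T" and near: "\<And>s. 0 \<le> s \<Longrightarrow> s < t \<Longrightarrow> u s < 1" for t
  proof -
    have "u t + d\<^sup>2 \<le> exp ((2 * L + 1) * t) * (u 0 + d\<^sup>2)"
    proof (rule Gronwall_affine[OF t(1)])
      show "continuous_on {0..t} u"
        by (rule continuous_on_subset[OF cu]) auto
    next
      fix s assume s: "0 < s" "s < t"
      have "at s within {0..} = at s"
        using s by (intro at_within_interior) simp
      then have "(y has_vector_derivative Y (y s)) (at s)" "(z has_vector_derivative X (z s)) (at s)"
        using y[of s] z[of s] s by auto
      then have "((\<lambda>s. y s - z s) has_vector_derivative Y (y s) - X (z s)) (at s)"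
        by (rule has_vector_derivative_diff)
      from has_derivative_inner[OF this[unfolded has_vector_derivative_def]
          this[unfolded has_vector_derivative_def]]
      show "(u has_real_derivative 2 * ((y s - z s) \<bullet> (Y (y s) - X (z s)))) (at s)"
        unfolding u_def power2_norm_eq_inner has_field_derivative_def
        by (rule has_derivative_eq_rhs) (simp add: fun_eq_iff inner_commute)
    next
      fix s assume s: "0 < s" "s < t"
      let ?n = "norm (y s - z s)"
      have zs: "norm (z s) \<le> r"
        using bound[of s] s t by auto
      have "?n\<^sup>2 < 1"
        using near[of s] s by (simp add: u_def)
      then have "?n < 1"
        by (simp add: power_less_one_iff)
      then have ys: "norm (y s) \<le> r + 1"
        using zs norm_triangle_sub[of "y s" "z s"] by linarith
      have "norm (Y (y s) - X (z s)) \<le> norm (Y (y s) - X (y s)) + norm (X (y s) - X (z s))"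
        using norm_triangle_ineq[of "Y (y s) - X (y s)" "X (y s) - X (z s)"] by simp
      also have "\<dots> \<le> d + L * ?n"
        using close[OF ys] Lip[OF ys, of "z s"] zs by linarith
      finally have "(y s - z s) \<bullet> (Y (y s) - X (z s)) \<le> ?n * (d + L * ?n)"
        by (meson norm_cauchy_schwarz mult_left_mono norm_ge_zero order_trans)
      moreover have "2 * (?n * d) \<le> ?n\<^sup>2 + d\<^sup>2"
        using sum_squares_bound[of ?n d] by (simp add: mult.assoc)
      moreover have "0 \<le> L * d\<^sup>2"
        using \<open>0 \<le> L\<close> by simp
      ultimately show "2 * ((y s - z s) \<bullet> (Y (y s) - X (z s))) \<le> (2 * L + 1) * (u s + d\<^sup>2)"
        unfolding u_def by (simp add: algebra_simps power2_eq_square)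
    qed
    also have "\<dots> \<le> C"
      unfolding C_def u_def using t \<open>0 \<le> L\<close> by (intro mult_right_mono) (auto intro!: mult_left_mono)
    finally show ?thesis
      using zero_le_power2[of d] by linarith
  qed
  have C1: "C < 1"
    using small by (simp add: C_def u_def)
  have near: "u s < 1" if s: "s \<in> {0..T}" for s
  proof (rule ccontr)
    assume "\<not> u s < 1"
    let ?A = "{s \<in> {0..T}. u s \<in> {1..}}"
    have "continuous_on {0..T} u"
      by (rule continuous_on_subset[OF cu]) auto
    then have "closed ({0..T} \<inter> u -` {1..})"
      by (intro continuous_closed_preimage) auto
    moreover have "{0..T} \<inter> u -` {1..} = ?A"
      by auto
    ultimately have "compact ?A"
      using compact_Int_closed[of "{0..T}" ?A] by (simp add: Int_absorb1 subset_iff)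
    moreover have "?A \<noteq> {}"
      using s \<open>\<not> u s < 1\<close> by auto
    ultimately obtain t1 where t1: "t1 \<in> ?A" "\<And>s. s \<in> ?A \<Longrightarrow> t1 \<le> s"
      using compact_attains_inf[of ?A] by blast
    have "u t1 \<le> C"
      using t1 by (intro est) (force simp: not_le[symmetric])+
    then show False
      using t1 C1 by auto
  qed
  have "u t \<le> C"
    using t near by (intro est) auto
  then show ?thesis
    by (simp add: C_def u_def)
qed

lemma Ck_on_imp_C1:
  assumes "Ck_on r S f" "1 \<le> r"
  shows "\<forall>x\<in>S. f differentiable (at x)" "continuous_on S (\<lambda>x. frechet_derivative f (at x) v)"
proof -
  obtain k where r: "r = Suc k"
    using assms(2) by (cases r) auto
  then show "\<forall>x\<in>S. f differentiable (at x)"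
    using assms(1) by simp
  have "Ck_on k S (\<lambda>x. frechet_derivative f (at x) v)"
    using assms(1) r by simp
  then show "continuous_on S (\<lambda>x. frechet_derivative f (at x) v)"
    by (cases k)
      (auto intro!: continuous_at_imp_continuous_on differentiable_imp_continuous_within)
qed

lemma C1_Lipschitz_on_balls:
  fixes X :: "vec3 \<Rightarrow> vec3"
  assumes "Ck_on r UNIV X" "1 \<le> r"
  obtains L where "0 \<le> L"
    "\<And>a b. norm a \<le> R \<Longrightarrow> norm b \<le> R \<Longrightarrow> norm (X a - X b) \<le> L * norm (a - b)"
proof -
  note C1 = Ck_on_imp_C1[OF assms]
  let ?D = "\<lambda>x. frechet_derivative X (at x)"
  have D: "(X has_derivative ?D x) (at x)" for x
    using C1(1) frechet_derivative_works by blast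
  have "\<exists>C. \<forall>x\<in>cball 0 R. norm (?D x b) \<le> C" for b
  proof -
    have "compact ((\<lambda>x. ?D x b) ` cball 0 R)"
      by (intro compact_continuous_image continuous_on_subset[OF C1(2)]) auto
    from compact_imp_bounded[OF this] show ?thesis
      by (auto simp: bounded_iff)
  qed
  then obtain C where C: "\<And>b x. x \<in> cball 0 R \<Longrightarrow> norm (?D x b) \<le> C b"
    by metis
  define L where "L = (\<Sum>b\<in>Basis. \<bar>C b\<bar>)"
  have "onorm (?D x) \<le> L" if x: "x \<in> cball 0 R" for x
  proof -
    have lin: "linear (?D x)"
      using D by (rule has_derivative_linear)
    have "norm (?D x v) \<le> L * norm v" for v
    proof -
      have "?D x v = ?D x (\<Sum>b\<in>Basis. (v \<bullet> b) *\<^sub>R b)"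
        by (simp add: euclidean_representation)
      also have "\<dots> = (\<Sum>b\<in>Basis. (v \<bullet> b) *\<^sub>R ?D x b)"
        using lin by (simp add: linear_sum linear_scale)
      also have "norm \<dots> \<le> (\<Sum>b\<in>Basis. norm v * \<bar>C b\<bar>)"
      proof (rule sum_norm_le)
        fix b :: vec3 assume "b \<in> Basis"
        then have "\<bar>v \<bullet> b\<bar> \<le> norm v" and "norm (?D x b) \<le> \<bar>C b\<bar>"
          using Basis_le_norm C[OF x, of b] by auto
        then show "norm ((v \<bullet> b) *\<^sub>R ?D x b) \<le> norm v * \<bar>C b\<bar>"
          by (simp add: mult_mono)
      qed
      finally show ?thesis
        by (simp add: L_def sum_distrib_left mult.commute)
    qed
    then show ?thesis
      by (intro onorm_bound) (auto simp: L_def intro: sum_nonneg)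
  qed
  then have "norm (X a - X b) \<le> L * norm (a - b)" if "norm a \<le> R" "norm b \<le> R" for a b
    using that D by (intro differentiable_bound[of "cball 0 R" X ?D])
      (auto intro: has_derivative_at_withinI)
  then show ?thesis
    by (intro that[of L]) (auto simp: L_def intro: sum_nonneg)
qed

text \<open>Only forward orbits are available, and no global Lipschitz constant; all comparisons are made
  on a ball around one orbit over a compact time interval.\<close>

locale C1_flow_family =
  fixes E :: "real set" and \<phi> :: "real \<Rightarrow> vec3 \<Rightarrow> vec3" and \<Phi> :: "real \<Rightarrow> real \<Rightarrow> vec3 \<Rightarrow> vec3"
    and r :: nat
  assumes r_ge_1: "1 \<le> r"
    and fields_Ck: "\<eta> \<in> E \<Longrightarrow> Ck_on r UNIV (\<phi> \<eta>)"
    and flows: "\<eta> \<in> E \<Longrightarrow> is_flow (\<phi> \<eta>) (\<Phi> \<eta>)"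
    and continuous_family: "C1_continuous_family E \<phi>"
begin

lemma flow_0: "\<eta> \<in> E \<Longrightarrow> \<Phi> \<eta> 0 x = x"
  using flows by (simp add: is_flow_def)

lemma flow_derivative:
  "\<eta> \<in> E \<Longrightarrow> 0 \<le> t \<Longrightarrow> ((\<lambda>s. \<Phi> \<eta> s x) has_vector_derivative \<phi> \<eta> (\<Phi> \<eta> t x)) (at t within {0..})"
  using flows by (simp add: is_flow_def)

lemma continuous_on_orbit: "\<eta> \<in> E \<Longrightarrow> continuous_on {0..} (\<lambda>t. \<Phi> \<eta> t x)"
  using flow_derivative has_vector_derivative_continuous
  by (fastforce simp: continuous_on_eq_continuous_within)

lemma orbit_bounded:
  assumes "\<eta> \<in> E"
  obtains b where "\<And>t. t \<in> {0..T} \<Longrightarrow> norm (\<Phi> \<eta> t x) \<le> b"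
proof -
  have "compact ((\<lambda>t. \<Phi> \<eta> t x) ` {0..T})"
    using assms by (intro compact_continuous_image continuous_on_subset[OF continuous_on_orbit]) auto
  from compact_imp_bounded[OF this] obtain b where "\<forall>t\<in>{0..T}. norm (\<Phi> \<eta> t x) \<le> b"
    by (auto simp: bounded_iff)
  then show ?thesis
    by (intro that) blast
qed

text \<open>Uniqueness of solutions is the estimate for two equal fields and equal initial values.\<close>

lemma flow_add:
  assumes \<eta>: "\<eta> \<in> E" and "0 \<le> s" "0 \<le> t"
  shows "\<Phi> \<eta> (s + t) x = \<Phi> \<eta> t (\<Phi> \<eta> s x)"
proof -
  obtain b where b: "\<And>u. u \<in> {0..s + t} \<Longrightarrow> norm (\<Phi> \<eta> u x) \<le> b"
    using orbit_bounded[OF \<eta>] by metis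
  obtain L where L: "0 \<le> L" "\<And>a c. norm a \<le> b + 1 \<Longrightarrow> norm c \<le> b + 1 \<Longrightarrow>
      norm (\<phi> \<eta> a - \<phi> \<eta> c) \<le> L * norm (a - c)"
    using C1_Lipschitz_on_balls[OF fields_Ck[OF \<eta>] r_ge_1] by metis
  have shifted: "((\<lambda>u. \<Phi> \<eta> (s + u) x) has_vector_derivative \<phi> \<eta> (\<Phi> \<eta> (s + u) x)) (at u within {0..})"
    if "0 \<le> u" for u
  proof -
    have "((\<lambda>v. \<Phi> \<eta> v x) \<circ> (\<lambda>u. s + u) has_vector_derivative 1 *\<^sub>R \<phi> \<eta> (\<Phi> \<eta> (s + u) x))
        (at u within {0..})"
    proof (rule vector_diff_chain_within)
      show "((\<lambda>u. s + u) has_vector_derivative 1) (at u within {0..})"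
        by (auto intro!: derivative_eq_intros)
      show "((\<lambda>v. \<Phi> \<eta> v x) has_vector_derivative \<phi> \<eta> (\<Phi> \<eta> (s + u) x))
          (at (s + u) within (\<lambda>u. s + u) ` {0..})"
        using assms that
        by (intro has_vector_derivative_within_subset[OF flow_derivative[OF \<eta>]]) auto
    qed
    then show ?thesis
      by (simp add: o_def)
  qed
  have "(norm (\<Phi> \<eta> t (\<Phi> \<eta> s x) - \<Phi> \<eta> (s + t) x))\<^sup>2 \<le>
      exp ((2 * L + 1) * t) * ((norm (\<Phi> \<eta> 0 (\<Phi> \<eta> s x) - \<Phi> \<eta> (s + 0) x))\<^sup>2 + 0\<^sup>2)"
    by (rule solutions_close[OF L(1) \<open>0 \<le> t\<close> shifted flow_derivative[OF \<eta>], where r = b])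
      (use assms b L(2) in \<open>auto simp: flow_0\<close>)
  then show ?thesis
    using \<eta> by (simp add: flow_0)
qed

text \<open>The fields are compared on a ball around the unperturbed orbit, where \<open>d\<close> bounds their
  distance.\<close>

lemma flow_close_on_interval:
  assumes \<eta>: "\<eta> \<in> E" and "0 \<le> T" "0 < e"
  obtains \<delta> where "0 < \<delta>"
    "\<And>\<eta>' x' t. \<eta>' \<in> E \<Longrightarrow> \<bar>\<eta>' - \<eta>\<bar> < \<delta> \<Longrightarrow> dist x' x < \<delta> \<Longrightarrow> t \<in> {0..T} \<Longrightarrow>
       dist (\<Phi> \<eta>' t x') (\<Phi> \<eta> t x) < e"
proof -
  obtain b where b: "\<And>u. u \<in> {0..T} \<Longrightarrow> norm (\<Phi> \<eta> u x) \<le> b"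
    using orbit_bounded[OF \<eta>] by metis
  obtain L where L: "0 \<le> L" "\<And>a c. norm a \<le> b + 1 \<Longrightarrow> norm c \<le> b + 1 \<Longrightarrow>
      norm (\<phi> \<eta> a - \<phi> \<eta> c) \<le> L * norm (a - c)"
    using C1_Lipschitz_on_balls[OF fields_Ck[OF \<eta>] r_ge_1] by metis
  define K where "K = exp ((2 * L + 1) * T)"
  have "0 < K"
    by (simp add: K_def)
  define m where "m = min 1 (e\<^sup>2)"
  have "0 < m"
    using \<open>0 < e\<close> by (simp add: m_def)
  \<comment> \<open>chosen such that \<open>K (d\<^sup>2 + d\<^sup>2) < m\<close>\<close>
  define d where "d = sqrt (m / (4 * K))"
  have d: "0 < d" "K * (d\<^sup>2 + d\<^sup>2) < m"
  proof -
    show "0 < d"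
      using \<open>0 < m\<close> \<open>0 < K\<close> by (simp add: d_def)
    have "d\<^sup>2 = m / (4 * K)"
      using \<open>0 < m\<close> \<open>0 < K\<close> unfolding d_def by (intro real_sqrt_pow2) simp
    then have "K * (d\<^sup>2 + d\<^sup>2) = m / 2"
      using \<open>0 < K\<close> by (simp add: field_simps)
    then show "K * (d\<^sup>2 + d\<^sup>2) < m"
      using \<open>0 < m\<close> by linarith
  qed
  obtain \<delta> where \<delta>: "0 < \<delta>"
    "\<And>\<eta>' a. \<eta>' \<in> E \<Longrightarrow> \<bar>\<eta>' - \<eta>\<bar> < \<delta> \<Longrightarrow> norm a \<le> b + 1 \<Longrightarrow> norm (\<phi> \<eta>' a - \<phi> \<eta> a) < d"
  proof -
    have "\<exists>\<delta>>0. \<forall>\<eta>'\<in>E. \<bar>\<eta>' - \<eta>\<bar> < \<delta> \<longrightarrow> (\<forall>a\<in>cball 0 (b + 1). norm (\<phi> \<eta>' a - \<phi> \<eta> a) < d \<and>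
        onorm (\<lambda>v. frechet_derivative (\<phi> \<eta>') (at a) v - frechet_derivative (\<phi> \<eta>) (at a) v) < d)"
      using continuous_family[unfolded C1_continuous_family_def, rule_format, OF \<eta>]
        compact_cball \<open>0 < d\<close> by blast
    then show ?thesis
      using that by (metis mem_cball_0)
  qed
  show ?thesis
  proof (rule that[of "min \<delta> d"])
    fix \<eta>' x' t assume *: "\<eta>' \<in> E" "\<bar>\<eta>' - \<eta>\<bar> < min \<delta> d" "dist x' x < min \<delta> d" "t \<in> {0..T}"
    let ?u0 = "(norm (\<Phi> \<eta>' 0 x' - \<Phi> \<eta> 0 x))\<^sup>2"
    have "norm (\<Phi> \<eta>' 0 x' - \<Phi> \<eta> 0 x) \<le> d"
      using *(3) by (simp add: flow_0[OF \<eta>] flow_0[OF *(1)] dist_norm)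
    then have "?u0 \<le> d\<^sup>2"
      by (intro power_mono norm_ge_zero)
    then have "K * (?u0 + d\<^sup>2) \<le> K * (d\<^sup>2 + d\<^sup>2)"
      using \<open>0 < K\<close> by (intro mult_left_mono) auto
    then have small: "K * (?u0 + d\<^sup>2) < m"
      using d(2) by linarith
    have "(norm (\<Phi> \<eta>' t x' - \<Phi> \<eta> t x))\<^sup>2 \<le> K * (?u0 + d\<^sup>2)"
      unfolding K_def
    proof (rule solutions_close[OF L(1) \<open>0 \<le> T\<close> flow_derivative[OF \<eta>] flow_derivative[OF *(1)]
          b L(2) _ _ *(4)])
      show "norm (\<phi> \<eta>' a - \<phi> \<eta> a) \<le> d" if "norm a \<le> b + 1" for a
        using \<delta>(2)[OF *(1) _ that] *(2) by simp
      show "exp ((2 * L + 1) * T) * (?u0 + d\<^sup>2) < 1"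
        using small by (simp add: K_def m_def)
    qed
    then have "(norm (\<Phi> \<eta>' t x' - \<Phi> \<eta> t x))\<^sup>2 < e\<^sup>2"
      using small by (simp add: m_def)
    then show "dist (\<Phi> \<eta>' t x') (\<Phi> \<eta> t x) < e"
      using \<open>0 < e\<close> by (simp add: dist_norm power2_less_imp_less)
  qed (use \<delta>(1) d(1) in auto)
qed

lemma continuous_on_flow:
  "continuous_on (E \<times> {0..} \<times> UNIV) (\<lambda>(\<eta>, t, x). \<Phi> \<eta> t x)"
  unfolding continuous_on_iff
proof (intro ballI allI impI)
  fix z :: "real \<times> real \<times> vec3" and e :: real
  assume "z \<in> E \<times> {0..} \<times> UNIV" "0 < e"
  then obtain \<eta> t x where z: "z = (\<eta>, t, x)" and \<eta>: "\<eta> \<in> E" and "0 \<le> t"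
    by auto
  obtain \<delta> where \<delta>: "0 < \<delta>"
    "\<And>\<eta>' x' s. \<eta>' \<in> E \<Longrightarrow> \<bar>\<eta>' - \<eta>\<bar> < \<delta> \<Longrightarrow> dist x' x < \<delta> \<Longrightarrow> s \<in> {0..t + 1} \<Longrightarrow>
       dist (\<Phi> \<eta>' s x') (\<Phi> \<eta> s x) < e / 2"
    using flow_close_on_interval[OF \<eta>, of "t + 1" "e / 2"] \<open>0 \<le> t\<close> \<open>0 < e\<close> by auto
  obtain \<delta>' where \<delta>': "0 < \<delta>'"
    "\<And>s. 0 \<le> s \<Longrightarrow> \<bar>s - t\<bar> < \<delta>' \<Longrightarrow> dist (\<Phi> \<eta> s x) (\<Phi> \<eta> t x) < e / 2"
    using continuous_on_orbit[OF \<eta>, of x] \<open>0 \<le> t\<close> \<open>0 < e\<close>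
    unfolding continuous_on_iff by (metis atLeast_iff dist_real_def half_gt_zero)
  show "\<exists>d>0. \<forall>z'\<in>E \<times> {0..} \<times> UNIV. dist z' z < d \<longrightarrow>
      dist (case z' of (\<eta>, t, x) \<Rightarrow> \<Phi> \<eta> t x) (case z of (\<eta>, t, x) \<Rightarrow> \<Phi> \<eta> t x) < e"
  proof (intro exI[of _ "min 1 (min \<delta> \<delta>')"] conjI ballI impI)
    fix z' assume "z' \<in> E \<times> {0..} \<times> (UNIV :: vec3 set)" and less: "dist z' z < min 1 (min \<delta> \<delta>')"
    then obtain \<eta>' s x' where z': "z' = (\<eta>', s, x')" and *: "\<eta>' \<in> E" "0 \<le> s"
      by auto
    have "dist \<eta>' \<eta> \<le> dist (\<eta>', s, x') (\<eta>, t, x)" "dist s t \<le> dist (\<eta>', s, x') (\<eta>, t, x)"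
      "dist x' x \<le> dist (\<eta>', s, x') (\<eta>, t, x)"
      using dist_fst_le[of "(\<eta>', s, x')" "(\<eta>, t, x)"] dist_snd_le[of "(\<eta>', s, x')" "(\<eta>, t, x)"]
        dist_fst_le[of "(s, x')" "(t, x)"] dist_snd_le[of "(s, x')" "(t, x)"] by auto
    then have "\<bar>\<eta>' - \<eta>\<bar> < \<delta>" "dist x' x < \<delta>" "\<bar>s - t\<bar> < \<delta>'" "\<bar>s - t\<bar> < 1"
      using less by (auto simp: dist_real_def z z')
    then have "dist (\<Phi> \<eta>' s x') (\<Phi> \<eta> s x) < e / 2" "dist (\<Phi> \<eta> s x) (\<Phi> \<eta> t x) < e / 2"
      using \<delta>(2)[of \<eta>' x' s] \<delta>'(2)[of s] * by auto
    then show "dist (case z' of (\<eta>, t, x) \<Rightarrow> \<Phi> \<eta> t x) (case z of (\<eta>, t, x) \<Rightarrow> \<Phi> \<eta> t x) < e"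
      unfolding z z' prod.case
      using dist_triangle[of "\<Phi> \<eta>' s x'" "\<Phi> \<eta> t x" "\<Phi> \<eta> s x"] by linarith
  qed (use \<delta>(1) \<delta>'(1) in auto)
qed

end

section \<open>Continuity of the return time\<close>

context C1_flow_family begin

lemma eventually_flow_close:
  assumes \<eta>: "\<eta> \<in> E" and "0 \<le> T" "0 < e"
  shows "\<forall>\<^sub>F z in at (\<eta>, x) within E \<times> A. \<forall>t\<in>{0..T}. dist (\<Phi> (fst z) t (snd z)) (\<Phi> \<eta> t x) < e"
proof -
  obtain \<delta> where \<delta>: "0 < \<delta>"
    "\<And>\<eta>' x' t. \<eta>' \<in> E \<Longrightarrow> \<bar>\<eta>' - \<eta>\<bar> < \<delta> \<Longrightarrow> dist x' x < \<delta> \<Longrightarrow> t \<in> {0..T} \<Longrightarrow>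
       dist (\<Phi> \<eta>' t x') (\<Phi> \<eta> t x) < e"
    using flow_close_on_interval[OF assms] by metis
  show ?thesis
    unfolding eventually_at
  proof (intro exI[of _ \<delta>] conjI ballI impI)
    fix z t assume z: "z \<in> E \<times> A" "z \<noteq> (\<eta>, x) \<and> dist z (\<eta>, x) < \<delta>" "t \<in> {0..T}"
    have "dist (fst z) \<eta> < \<delta>" "dist (snd z) x < \<delta>"
      using z(2) dist_fst_le[of z "(\<eta>, x)"] dist_snd_le[of z "(\<eta>, x)"] by auto
    then show "dist (\<Phi> (fst z) t (snd z)) (\<Phi> \<eta> t x) < e"
      using z by (intro \<delta>(2)) (auto simp: dist_real_def)
  qed (rule \<delta>(1))
qed

lemma continuous_on_orbit_between: "\<eta> \<in> E \<Longrightarrow> 0 \<le> a \<Longrightarrow> continuous_on {a..b} (\<lambda>t. \<Phi> \<eta> t x)"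
  by (rule continuous_on_subset[OF continuous_on_orbit]) auto

end

locale return_family = C1_flow_family +
  fixes M :: "vec3 set" and \<Gamma> :: "real \<Rightarrow> vec3 set" and \<sigma> :: "real \<Rightarrow> vec3" and \<rho> :: "real \<Rightarrow> real"
    and c :: real
  assumes poincare: "\<eta> \<in> E \<Longrightarrow> poincare_section (\<phi> \<eta>) (\<Phi> \<eta>) M (\<Gamma> \<eta>)"
    and leaf: "\<eta> \<in> E \<Longrightarrow> \<Gamma> \<eta> = singular_leaf (\<Phi> \<eta>) M (\<sigma> \<eta>) (\<rho> \<eta>)"
    and section_off_singularity: "\<eta> \<in> E \<Longrightarrow> M \<inter> ball (\<sigma> \<eta>) (\<rho> \<eta>) = {}"
    and c_pos: "0 < c"
    and return_time_ge: "\<eta> \<in> E \<Longrightarrow> x \<in> M - \<Gamma> \<eta> \<Longrightarrow> c \<le> return_time (\<Phi> \<eta>) M x"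
begin

lemma compact_section: "\<eta> \<in> E \<Longrightarrow> compact M"
  using poincare by (auto simp: poincare_section_def compact_surface_def)

text \<open>Once in the local stable manifold the orbit stays near the singularity, off the section.\<close>

lemma no_return_from_leaf:
  assumes \<eta>: "\<eta> \<in> E" and x: "x \<in> \<Gamma> \<eta>" and "0 < t"
  shows "\<Phi> \<eta> t x \<notin> M"
proof -
  obtain t0 where t0: "0 \<le> t0" "\<Phi> \<eta> t0 x \<in> local_stable_manifold (\<Phi> \<eta>) (\<sigma> \<eta>) (\<rho> \<eta>)"
    "\<And>s. s \<in> {0<..t0} \<Longrightarrow> \<Phi> \<eta> s x \<notin> M"
    using x unfolding leaf[OF \<eta>] singular_leaf_def by auto
  show ?thesis
  proof (cases "t \<le> t0")
    case True
    then show ?thesis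
      using t0(3) \<open>0 < t\<close> by auto
  next
    case False
    then have "\<Phi> \<eta> t x = \<Phi> \<eta> (t - t0) (\<Phi> \<eta> t0 x)"
      using flow_add[OF \<eta> t0(1), of "t - t0" x] by simp
    also have "\<dots> \<in> ball (\<sigma> \<eta>) (\<rho> \<eta>)"
      using t0(2) False by (auto simp: local_stable_manifold_def)
    finally show ?thesis
      using section_off_singularity[OF \<eta>] by auto
  qed
qed

lemma return_time_le:
  assumes \<eta>: "\<eta> \<in> E" and "x \<in> M" "0 < t" "\<Phi> \<eta> t x \<in> M"
  shows "x \<notin> \<Gamma> \<eta>" "return_time (\<Phi> \<eta>) M x \<le> t"
proof -
  show "x \<notin> \<Gamma> \<eta>"
    using no_return_from_leaf[OF \<eta>] assms by blast
  have "bdd_below {t. 0 < t \<and> \<Phi> \<eta> t x \<in> M}"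
    by (intro bdd_belowI[of _ 0]) auto
  then show "return_time (\<Phi> \<eta>) M x \<le> t"
    unfolding return_time_def using assms by (intro cInf_lower) auto
qed

lemma return_map_in_section:
  assumes \<eta>: "\<eta> \<in> E" and x: "x \<in> M - \<Gamma> \<eta>"
  shows "\<Phi> \<eta> (return_time (\<Phi> \<eta>) M x) x \<in> surface_interior M"
  using poincare[OF \<eta>] x by (auto simp: poincare_section_def return_map_def)

text \<open>Over the time interval from \<^term>\<open>c\<close> to \<^term>\<open>a\<close> the orbit has positive distance to the
  section. Starting at \<^term>\<open>c\<close> leaves out the initial point, which may lie on the section.\<close>

lemma eventually_no_early_return:
  assumes \<eta>: "\<eta> \<in> E" and none: "\<And>t. c \<le> t \<Longrightarrow> t \<le> a \<Longrightarrow> \<Phi> \<eta> t x \<notin> M"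
  shows "\<forall>\<^sub>F z in at (\<eta>, x) within E \<times> M. \<forall>t\<in>{c..a}. \<Phi> (fst z) t (snd z) \<notin> M"
proof (cases "c \<le> a")
  case True
  let ?K = "(\<lambda>t. \<Phi> \<eta> t x) ` {c..a}"
  have "compact ?K"
    using \<eta> c_pos by (intro compact_continuous_image continuous_on_orbit_between) auto
  moreover have "closed M"
    using compact_section[OF \<eta>] by (rule compact_imp_closed)
  moreover have "?K \<inter> M = {}"
    using none by auto
  ultimately obtain d where d: "0 < d" "\<And>y m. y \<in> ?K \<Longrightarrow> m \<in> M \<Longrightarrow> d \<le> dist y m"
    using separate_compact_closed[of ?K M] by metis
  have "0 \<le> a"
    using True c_pos by linarith
  from eventually_flow_close[OF \<eta> this d(1), of x M] show ?thesis
  proof eventually_elim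
    case (elim z)
    show ?case
    proof (intro ballI notI)
      fix t assume t: "t \<in> {c..a}" "\<Phi> (fst z) t (snd z) \<in> M"
      have "d \<le> dist (\<Phi> \<eta> t x) (\<Phi> (fst z) t (snd z))"
        using t by (intro d(2)) auto
      moreover have "dist (\<Phi> (fst z) t (snd z)) (\<Phi> \<eta> t x) < d"
        using t c_pos elim by auto
      ultimately show False
        by (simp add: dist_commute)
    qed
  qed
qed simp

text \<open>At the return point the third chart coordinate changes sign along the orbit, by
  transversality. Nearby orbits show the same sign change while they stay in the chart, and there a
  zero of that coordinate is a point of the section because the return point is interior.\<close>

lemma eventually_return_before:
  assumes \<eta>: "\<eta> \<in> E" and x: "x \<in> M - \<Gamma> \<eta>" and "0 < e"
  shows "\<forall>\<^sub>F z in at (\<eta>, x) within E \<times> M.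
    \<exists>t>0. t < return_time (\<Phi> \<eta>) M x + e \<and> \<Phi> (fst z) t (snd z) \<in> M"
proof -
  define t0 where "t0 = return_time (\<Phi> \<eta>) M x"
  define y where "y = \<Phi> \<eta> t0 x"
  have "0 < t0"
    using return_time_ge[OF \<eta> x] c_pos by (simp add: t0_def)
  have "y \<in> surface_interior M"
    using return_map_in_section[OF \<eta> x] by (simp add: y_def t0_def)
  then obtain W \<Psi> where "y \<in> M" and chart: "surface_chart M y W \<Psi> False False"
    by (auto simp: surface_interior_def)
  then have "open W" "y \<in> W" "\<Psi> y = 0" and W: "M \<inter> W = {p\<in>W. \<Psi> p $ 3 = 0}" and "Ck_on 1 W \<Psi>"
    by (auto simp: surface_chart_def local_coordinates_def)
  define D where "D = frechet_derivative \<Psi> (at y)"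
  have "D (\<phi> \<eta> y) $ 3 \<noteq> 0"
    using poincare[OF \<eta>] \<open>y \<in> M\<close> chart
    unfolding poincare_section_def transverse_def D_def by blast
  have \<Psi>: "\<forall>p\<in>W. \<Psi> differentiable (at p)"
    using Ck_on_imp_C1[OF \<open>Ck_on 1 W \<Psi>\<close>] by simp
  then have "(\<Psi> has_derivative D) (at y)"
    using \<open>y \<in> W\<close> frechet_derivative_works D_def by blast
  have cont_\<Psi>: "continuous_on W \<Psi>"
    using \<Psi> by (auto intro!: continuous_at_imp_continuous_on differentiable_imp_continuous_within)
  \<comment> \<open>an orientation of the chart for which \<open>h\<close> increases along the orbit at the return\<close>
  define k where "k = sgn (D (\<phi> \<eta> y) $ 3)"
  define h where "h = (\<lambda>p. k * \<Psi> p $ 3)"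
  have "k \<noteq> 0"
    using \<open>D (\<phi> \<eta> y) $ 3 \<noteq> 0\<close> by (simp add: k_def sgn_eq_0_iff)
  have cont_h: "continuous_on W h"
    unfolding h_def by (intro continuous_intros cont_\<Psi>)
  have "((\<lambda>t. \<Phi> \<eta> t x) has_vector_derivative \<phi> \<eta> y) (at t0)"
    using flow_derivative[OF \<eta>, of t0 x] \<open>0 < t0\<close> at_within_interior[of t0 "{0..}"]
    by (simp add: y_def)
  then have "((\<lambda>t. \<Psi> (\<Phi> \<eta> t x)) has_vector_derivative D (\<phi> \<eta> y)) (at t0)"
    using \<open>(\<Psi> has_derivative D) (at y)\<close>
    by (simp add: has_vector_derivative_def y_def)
      (drule (1) has_derivative_compose, simp add: linear_scale has_derivative_linear)
  then have "((\<lambda>t. \<Psi> (\<Phi> \<eta> t x) $ 3) has_vector_derivative D (\<phi> \<eta> y) $ 3) (at t0)"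
    by (rule bounded_linear.has_vector_derivative[OF bounded_linear_vec_nth])
  then have h_deriv: "((\<lambda>t. h (\<Phi> \<eta> t x)) has_real_derivative k * (D (\<phi> \<eta> y) $ 3)) (at t0)"
    unfolding h_def by (intro DERIV_cmult) (simp add: has_real_derivative_iff_has_vector_derivative)
  have h_pos: "0 < k * (D (\<phi> \<eta> y) $ 3)"
    using \<open>D (\<phi> \<eta> y) $ 3 \<noteq> 0\<close> by (simp add: k_def sgn_if)
  obtain d1 where "0 < d1"
    and d1: "\<And>s. 0 < s \<Longrightarrow> s < d1 \<Longrightarrow> h (\<Phi> \<eta> t0 x) < h (\<Phi> \<eta> (t0 + s) x)"
    using DERIV_pos_inc_right[OF h_deriv h_pos] by auto
  obtain d2 where "0 < d2"
    and d2: "\<And>s. 0 < s \<Longrightarrow> s < d2 \<Longrightarrow> h (\<Phi> \<eta> (t0 - s) x) < h (\<Phi> \<eta> t0 x)"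
    using DERIV_pos_inc_left[OF h_deriv h_pos] by auto
  have "h (\<Phi> \<eta> t0 x) = 0"
    using \<open>\<Psi> y = 0\<close> by (simp add: h_def y_def)
  obtain d3 where "0 < d3" and d3: "\<And>t. 0 \<le> t \<Longrightarrow> \<bar>t - t0\<bar> < d3 \<Longrightarrow> \<Phi> \<eta> t x \<in> W"
  proof -
    obtain e1 where e1: "0 < e1" "ball y e1 \<subseteq> W"
      using \<open>open W\<close> \<open>y \<in> W\<close> open_contains_ball by blast
    then obtain d where "0 < d" "\<forall>t\<in>{0..}. dist t t0 < d \<longrightarrow> dist (\<Phi> \<eta> t x) (\<Phi> \<eta> t0 x) < e1"
      using continuous_on_orbit[OF \<eta>, of x] \<open>0 < t0\<close> unfolding continuous_on_iff
      by (meson atLeast_iff less_imp_le)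
    then show ?thesis
      using e1 by (intro that[of d]) (auto simp: y_def dist_real_def dist_commute subset_iff)
  qed
  define s where "s = min (min d1 d2) (min (min d3 e) t0) / 2"
  have s: "0 < s" "s < d1" "s < d2" "s < d3" "s < e" "s < t0"
    using \<open>0 < d1\<close> \<open>0 < d2\<close> \<open>0 < d3\<close> \<open>0 < e\<close> \<open>0 < t0\<close> by (auto simp: s_def min_def)
  define a where "a = t0 - s"
  define b where "b = t0 + s"
  have ab: "0 < a" "a < b" "b < t0 + e"
    using s by (auto simp: a_def b_def)
  have "h (\<Phi> \<eta> a x) < 0" "0 < h (\<Phi> \<eta> b x)"
    using d1[of s] d2[of s] s \<open>h (\<Phi> \<eta> t0 x) = 0\<close> by (auto simp: a_def b_def)
  have inW: "\<Phi> \<eta> t x \<in> W" if "t \<in> {a..b}" for t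
    using that s d3[of t] by (auto simp: a_def b_def)
  obtain e1 where e1: "0 < e1" "\<And>p. dist p (\<Phi> \<eta> a x) < e1 \<Longrightarrow> p \<in> W \<and> h p < 0"
  proof -
    have "open {p\<in>W. h p \<in> {..<0}}"
      using continuous_open_preimage[OF cont_h \<open>open W\<close>, of "{..<0}"]
      by (simp add: vimage_def Int_def)
    moreover have "\<Phi> \<eta> a x \<in> {p\<in>W. h p \<in> {..<0}}"
      using inW[of a] ab \<open>h (\<Phi> \<eta> a x) < 0\<close> by simp
    ultimately show ?thesis
      using that unfolding open_dist by (metis (mono_tags, lifting) lessThan_iff mem_Collect_eq)
  qed
  obtain e2 where e2: "0 < e2" "\<And>p. dist p (\<Phi> \<eta> b x) < e2 \<Longrightarrow> p \<in> W \<and> 0 < h p"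
  proof -
    have "open {p\<in>W. h p \<in> {0<..}}"
      using continuous_open_preimage[OF cont_h \<open>open W\<close>, of "{0<..}"]
      by (simp add: vimage_def Int_def)
    moreover have "\<Phi> \<eta> b x \<in> {p\<in>W. h p \<in> {0<..}}"
      using inW[of b] ab \<open>0 < h (\<Phi> \<eta> b x)\<close> by simp
    ultimately show ?thesis
      using that unfolding open_dist by (metis (mono_tags, lifting) greaterThan_iff mem_Collect_eq)
  qed
  obtain e3 where e3: "0 < e3" "\<And>t p. t \<in> {a..b} \<Longrightarrow> dist p (\<Phi> \<eta> t x) < e3 \<Longrightarrow> p \<in> W"
  proof -
    let ?K = "(\<lambda>t. \<Phi> \<eta> t x) ` {a..b}"
    have "compact ?K"
      using \<eta> ab by (intro compact_continuous_image continuous_on_orbit_between) auto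
    moreover have "closed (- W)" "?K \<inter> (- W) = {}"
      using \<open>open W\<close> inW by auto
    ultimately obtain d where d: "0 < d" "\<And>q p. q \<in> ?K \<Longrightarrow> p \<in> - W \<Longrightarrow> d \<le> dist q p"
      using separate_compact_closed[of ?K "- W"] by metis
    have "p \<in> W" if "t \<in> {a..b}" "dist p (\<Phi> \<eta> t x) < d" for t p
      using d(2)[of "\<Phi> \<eta> t x" p] that by (auto simp: dist_commute not_le[symmetric])
    then show ?thesis
      using that d(1) by blast
  qed
  have pos: "0 < min e1 (min e2 e3)" and "0 \<le> b"
    using e1 e2 e3 ab by auto
  have "\<forall>\<^sub>F z in at (\<eta>, x) within E \<times> M. z \<in> E \<times> M"
    by (auto simp: eventually_at_filter)
  with eventually_flow_close[OF \<eta> \<open>0 \<le> b\<close> pos, of x M] show ?thesis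
  proof eventually_elim
    case (elim z)
    let ?y = "\<lambda>t. \<Phi> (fst z) t (snd z)"
    have near: "dist (?y t) (\<Phi> \<eta> t x) < min e1 (min e2 e3)" if "t \<in> {a..b}" for t
      using elim(1) that ab by auto
    have inW': "?y t \<in> W" if "t \<in> {a..b}" for t
      using e3(2)[OF that] near[OF that] by auto
    have "h (?y a) \<le> 0" "0 \<le> h (?y b)"
      using e1(2)[of "?y a"] e2(2)[of "?y b"] near[of a] near[of b] ab by auto
    moreover have "continuous_on {a..b} (\<lambda>t. h (?y t))"
      using elim(2) ab inW'
      by (intro continuous_on_compose2[OF cont_h] continuous_on_orbit_between) auto
    ultimately obtain t where t: "a \<le> t" "t \<le> b" "h (?y t) = 0"
      using IVT'[of "\<lambda>t. h (?y t)" a 0 b] ab by auto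
    then have "?y t \<in> M"
      using W inW'[of t] \<open>k \<noteq> 0\<close> by (auto simp: h_def)
    then show ?case
      using t ab by (intro exI[of _ t]) (auto simp: t0_def)
  qed
qed

text \<open>Reciprocal return time, so that the blow-up of the return time at the singular leaf
  becomes continuity with value 0.\<close>

definition return_rate :: "real \<times> vec3 \<Rightarrow> real" where
  "return_rate z = (if snd z \<in> \<Gamma> (fst z) then 0 else inverse (return_time (\<Phi> (fst z)) M (snd z)))"

lemma return_rate_less:
  assumes \<eta>: "\<eta> \<in> E" and x: "x \<in> M" and "0 < b"
    and none: "\<And>t. c \<le> t \<Longrightarrow> t \<le> 1 / b \<Longrightarrow> \<Phi> \<eta> t x \<notin> M"
  shows "return_rate (\<eta>, x) < b"
proof (cases "x \<in> \<Gamma> \<eta>")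
  case True
  then show ?thesis
    using \<open>0 < b\<close> by (simp add: return_rate_def)
next
  case False
  let ?t = "return_time (\<Phi> \<eta>) M x"
  have "c \<le> ?t"
    using return_time_ge[OF \<eta>] False x by simp
  moreover have "\<Phi> \<eta> ?t x \<in> M"
    using return_map_in_section[OF \<eta>] False x by (simp add: surface_interior_def)
  ultimately have "1 / b < ?t"
    using none[of ?t] by linarith
  then show ?thesis
    using False \<open>0 < b\<close> \<open>c \<le> ?t\<close> c_pos by (simp add: return_rate_def field_simps)
qed

lemma return_rate_greater:
  assumes \<eta>: "\<eta> \<in> E" and x: "x \<in> M" and "0 < a" "0 < t" "t < 1 / a" "\<Phi> \<eta> t x \<in> M"
  shows "a < return_rate (\<eta>, x)"
proof -
  have "x \<notin> \<Gamma> \<eta>" "return_time (\<Phi> \<eta>) M x < 1 / a"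
    using return_time_le[OF \<eta> x \<open>0 < t\<close>] assms by auto
  moreover have "0 < return_time (\<Phi> \<eta>) M x"
    using return_time_ge[OF \<eta>, of x] c_pos x \<open>x \<notin> \<Gamma> \<eta>\<close> by auto
  ultimately show ?thesis
    using \<open>0 < a\<close> by (simp add: return_rate_def field_simps)
qed

lemma return_rate_nonneg: "\<eta> \<in> E \<Longrightarrow> x \<in> M \<Longrightarrow> 0 \<le> return_rate (\<eta>, x)"
  using return_time_ge[of \<eta> x] c_pos by (auto simp: return_rate_def)

text \<open>The rate is upper semicontinuous since no early return appears, and lower semicontinuous
  since a return persists.\<close>

lemma continuous_on_return_rate: "continuous_on (E \<times> M) return_rate"
  unfolding continuous_on_def
proof
  fix z assume "z \<in> E \<times> M"
  then obtain \<eta> x where z: "z = (\<eta>, x)" and \<eta>: "\<eta> \<in> E" and x: "x \<in> M"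
    by auto
  have dom: "\<forall>\<^sub>F w in at z within E \<times> M. fst w \<in> E \<and> snd w \<in> M"
    by (auto simp: eventually_at_filter mem_Times_iff)
  show "(return_rate \<longlongrightarrow> return_rate z) (at z within E \<times> M)"
  proof (rule order_tendstoI)
    fix b assume b: "return_rate z < b"
    then have "0 < b"
      using return_rate_nonneg[OF \<eta> x] z by simp
    have none: "\<Phi> \<eta> t x \<notin> M" if "c \<le> t" "t \<le> 1 / b" for t
    proof
      assume "\<Phi> \<eta> t x \<in> M"
      then have "x \<notin> \<Gamma> \<eta>" "return_time (\<Phi> \<eta>) M x \<le> t"
        using return_time_le[OF \<eta> x, of t] that c_pos by auto
      moreover have "0 < return_time (\<Phi> \<eta>) M x"
        using return_time_ge[OF \<eta>, of x] c_pos x \<open>x \<notin> \<Gamma> \<eta>\<close> by auto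
      ultimately have "b \<le> return_rate z"
        using that \<open>0 < b\<close> by (simp add: z return_rate_def field_simps)
          (meson mult_left_mono order_trans less_imp_le)
      then show False
        using b by simp
    qed
    have "\<forall>\<^sub>F w in at (\<eta>, x) within E \<times> M. \<forall>t\<in>{c..1 / b}. \<Phi> (fst w) t (snd w) \<notin> M"
      by (rule eventually_no_early_return[OF \<eta>]) (rule none)
    from this dom[unfolded z]
    show "\<forall>\<^sub>F w in at z within E \<times> M. return_rate w < b"
      unfolding z
    proof eventually_elim
      case (elim w)
      then show ?case
        using return_rate_less[of "fst w" "snd w" b] \<open>0 < b\<close> by auto
    qed
  next
    fix a assume a: "a < return_rate z"
    show "\<forall>\<^sub>F w in at z within E \<times> M. a < return_rate w"
    proof (cases "a < 0")
      case True
      from dom show ?thesis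
      proof eventually_elim
        case (elim w)
        then show ?case
          using return_rate_nonneg[of "fst w" "snd w"] True by simp
      qed
    next
      case False
      obtain a' where a': "a < a'" "a' < return_rate z"
        using a dense by blast
      then have "0 < a'"
        using False by simp
      then have xG: "x \<in> M - \<Gamma> \<eta>" and "a' < inverse (return_time (\<Phi> \<eta>) M x)"
        using a' x by (auto simp: z return_rate_def split: if_splits)
      moreover have "0 < return_time (\<Phi> \<eta>) M x"
        using return_time_ge[OF \<eta> xG] c_pos by auto
      ultimately have "0 < 1 / a' - return_time (\<Phi> \<eta>) M x"
        using \<open>0 < a'\<close> by (simp add: field_simps)
      from eventually_return_before[OF \<eta> xG this] dom[unfolded z]
      show ?thesis
        unfolding z
      proof eventually_elim
        case (elim w)
        then obtain t where "0 < t" "t < 1 / a'" "\<Phi> (fst w) t (snd w) \<in> M"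
          by auto
        then show ?case
          using return_rate_greater[of "fst w" "snd w" a' t] elim \<open>0 < a'\<close> a'(1) by simp
      qed
    qed
  qed
qed

end

section \<open>Measures on suspensions\<close>

text \<open>Where the masses of preimages do not form a measure, \<^term>\<open>distr M N f\<close> is null; so the
  bound holds for every \<^term>\<open>f\<close>, and the mass of the suspension measure survives the projection
  to the quotient.\<close>

lemma emeasure_distr_le: "emeasure (distr M N f) A \<le> emeasure M (space M)"
  unfolding distr_def emeasure_measure_of_conv by (auto intro: emeasure_space)

lemma measurable_borel_of:
  assumes "continuous_map X euclidean f" "sets N = sets (borel_of X)"
  shows "f \<in> borel_measurable N"
proof -
  have "space N = topspace X" "sets N = sigma_sets (topspace X) {W. openin X W}"
    using assms(2) sets_eq_imp_space_eq[OF assms(2)]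
    by (auto simp: borel_of_def sets_measure_of_conv space_measure_of_conv dest: openin_subset)
  then show ?thesis
    using assms(1) by (intro borel_measurableI)
      (auto simp: continuous_map_def vimage_def Int_def conj_commute intro!: sigma_sets.Basic)
qed

lemma borel_measurable_continuous_on_Times_halfline:
  fixes g :: "'a::second_countable_topology \<times> real \<Rightarrow> 'b::topological_space"
  assumes g: "continuous_on (A \<times> {0..}) g" and N: "sets N = sets (restrict_space borel A)"
  shows "g \<in> borel_measurable (N \<Otimes>\<^sub>M restrict_space lborel {0..})"
proof -
  let ?P = "N \<Otimes>\<^sub>M restrict_space lborel {0::real..}"
  have sp: "space ?P = A \<times> {0..}"
    using sets_eq_imp_space_eq[OF N] by (simp add: space_pair_measure space_restrict_space)
  have "fst \<in> ?P \<rightarrow>\<^sub>M restrict_space borel A" "snd \<in> ?P \<rightarrow>\<^sub>M restrict_space borel {0..}"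
    using measurable_fst[of N] measurable_snd[of N]
    by (auto simp: measurable_cong_sets[OF refl N[symmetric]]
        measurable_cong_sets[OF refl sets_restrict_space_cong[OF sets_lborel, symmetric]])
  then have "fst \<in> ?P \<rightarrow>\<^sub>M borel" "snd \<in> ?P \<rightarrow>\<^sub>M borel"
    by (auto simp: measurable_restrict_space2_iff)
  then have "(\<lambda>z. (fst z, snd z)) \<in> ?P \<rightarrow>\<^sub>M borel"
    by (rule borel_measurable_Pair)
  then have "(\<lambda>z. z) \<in> ?P \<rightarrow>\<^sub>M restrict_space borel (A \<times> {0..})"
    using sp by (intro measurable_restrict_space2) auto
  from measurable_compose[OF this borel_measurable_continuous_on_restrict[OF g]] show ?thesis
    by simp
qed

lemma sigma_finite_halfline: "sigma_finite_measure (restrict_space lborel {0::real..})"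
  by (rule sigma_finite_measure_restrict_space[OF lborel.sigma_finite_measure_axioms]) simp

lemma borel_measurable_under_roof:
  assumes "\<tau> \<in> borel_measurable N"
  shows "(\<lambda>(p, s). indicator {0..<\<tau> p} s :: real)
    \<in> borel_measurable (N \<Otimes>\<^sub>M restrict_space lborel {0::real..})"
proof -
  let ?P = "N \<Otimes>\<^sub>M restrict_space lborel {0::real..}"
  have [measurable]: "(\<lambda>z. \<tau> (fst z)) \<in> borel_measurable ?P" "snd \<in> borel_measurable ?P"
    using measurable_compose[OF measurable_fst assms] measurable_snd[of N "restrict_space lborel {0::real..}"]
    by (auto simp: measurable_restrict_space2_iff)
  have "(\<lambda>z. if 0 \<le> snd z \<and> snd z < \<tau> (fst z) then 1 else 0 :: real) \<in> borel_measurable ?P"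
    by measurable
  then show ?thesis
    by (rule measurable_cong[THEN iffD1, rotated]) (auto simp: indicator_def)
qed

text \<open>For a negative total roof the density vanishes, which the cut-off of the normalising
  constant at 0 takes into account.\<close>

lemma susp_measure_eq_density:
  "susp_measure N \<tau> = density (N \<Otimes>\<^sub>M restrict_space lborel {0..})
     (\<lambda>z. ennreal (indicator {0..<\<tau> (fst z)} (snd z) * max 0 (1 / (\<integral>p. \<tau> p \<partial>N))))"
proof -
  have "(\<lambda>(p, s). ennreal (indicator {0..<\<tau> p} s / (\<integral>p. \<tau> p \<partial>N))) =
    (\<lambda>z. ennreal (indicator {0..<\<tau> (fst z)} (snd z) * max 0 (1 / (\<integral>p. \<tau> p \<partial>N))))"
    by (auto simp: fun_eq_iff indicator_def max_def ennreal_neg)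
  then show ?thesis
    by (simp add: susp_measure_def)
qed

lemma borel_measurable_susp_density:
  assumes "\<tau> \<in> borel_measurable N"
  shows "(\<lambda>z. indicator {0..<\<tau> (fst z)} (snd z) * max 0 (1 / (\<integral>p. \<tau> p \<partial>N)) :: real)
    \<in> borel_measurable (N \<Otimes>\<^sub>M restrict_space lborel {0..})"
  using borel_measurable_under_roof[OF assms] by (simp add: case_prod_beta)

lemma finite_susp_measure:
  assumes \<tau>: "integrable N \<tau>"
  shows "finite_measure (susp_measure N \<tau>)"
proof (rule finite_measureI)
  interpret sigma_finite_measure "restrict_space lborel {0::real..}"
    by (rule sigma_finite_halfline)
  let ?P = "N \<Otimes>\<^sub>M restrict_space lborel {0::real..}"
  let ?k = "max 0 (1 / (\<integral>p. \<tau> p \<partial>N))"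
  let ?d = "\<lambda>z. ennreal (indicator {0..<\<tau> (fst z)} (snd z) * ?k)"
  have [measurable]: "\<tau> \<in> borel_measurable N"
    using \<tau> by simp
  have d: "?d \<in> borel_measurable ?P"
    by (intro measurable_compose[OF _ measurable_ennreal] borel_measurable_susp_density) simp
  have inner: "(\<integral>\<^sup>+ s. ?d (p, s) \<partial>restrict_space lborel {0..}) \<le> ennreal ?k * ennreal (\<tau> p)" for p
  proof -
    have "(\<integral>\<^sup>+ s. ?d (p, s) \<partial>restrict_space lborel {0..})
        = (\<integral>\<^sup>+ s. ennreal ?k * indicator {0..<\<tau> p} s \<partial>lborel)"
      by (subst nn_integral_restrict_space)
        (auto intro!: nn_integral_cong simp: indicator_def)
    also have "\<dots> = ennreal ?k * emeasure lborel {0..<\<tau> p}"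
      by (rule nn_integral_cmult_indicator) simp
    also have "emeasure lborel {0..<\<tau> p} = ennreal (\<tau> p)"
      by (cases "0 \<le> \<tau> p") (simp_all add: ennreal_neg)
    finally show ?thesis
      by simp
  qed
  have "emeasure (susp_measure N \<tau>) (space (susp_measure N \<tau>)) = (\<integral>\<^sup>+ z. ?d z \<partial>?P)"
    unfolding susp_measure_eq_density
    by (subst emeasure_density[OF d]) (auto intro!: nn_integral_cong simp: indicator_def)
  also have "\<dots> = (\<integral>\<^sup>+ p. \<integral>\<^sup>+ s. ?d (p, s) \<partial>restrict_space lborel {0..} \<partial>N)"
    by (rule nn_integral_fst[OF d, symmetric])
  also have "\<dots> \<le> (\<integral>\<^sup>+ p. ennreal ?k * ennreal (\<tau> p) \<partial>N)"
    by (intro nn_integral_mono inner)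
  also have "\<dots> = ennreal ?k * (\<integral>\<^sup>+ p. ennreal (\<tau> p) \<partial>N)"
    by (rule nn_integral_cmult) simp
  also have "\<dots> < \<infinity>"
    using \<tau> by (auto simp: real_integrable_def ennreal_mult_less_top less_top)
  finally show "emeasure (susp_measure N \<tau>) (space (susp_measure N \<tau>)) \<noteq> \<infinity>"
    by simp
qed

lemma sets_susp_measure: "sets (susp_measure N \<tau>) = sets (N \<Otimes>\<^sub>M restrict_space lborel {0..})"
  by (simp add: susp_measure_def)

lemma integral_susp_measure:
  fixes g :: "'p \<times> real \<Rightarrow> real"
  assumes "sigma_finite_measure N" and \<tau>: "integrable N \<tau>"
    and g: "g \<in> borel_measurable (N \<Otimes>\<^sub>M restrict_space lborel {0..})"
    and bound: "\<And>z. z \<in> space N \<times> {0..} \<Longrightarrow> \<bar>g z\<bar> \<le> C"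
  shows "(\<integral>z. g z \<partial>susp_measure N \<tau>) =
    max 0 (1 / (\<integral>p. \<tau> p \<partial>N)) * (\<integral>p. (LINT s:{0..\<tau> p}|lborel. g (p, s)) \<partial>N)"
proof -
  interpret pair_sigma_finite N "restrict_space lborel {0::real..}"
    using assms(1) sigma_finite_halfline by (rule pair_sigma_finite.intro)
  interpret S: finite_measure "susp_measure N \<tau>"
    by (rule finite_susp_measure[OF \<tau>])
  let ?P = "N \<Otimes>\<^sub>M restrict_space lborel {0::real..}"
  let ?k = "max 0 (1 / (\<integral>p. \<tau> p \<partial>N))"
  let ?d = "\<lambda>z. indicator {0..<\<tau> (fst z)} (snd z) * ?k"
  have d: "?d \<in> borel_measurable ?P"
    using \<tau> by (intro borel_measurable_susp_density) simp
  have "g \<in> borel_measurable (susp_measure N \<tau>)"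
    using g by (simp add: measurable_cong_sets[OF sets_susp_measure refl])
  moreover have "space (susp_measure N \<tau>) = space N \<times> {0..}"
    using sets_eq_imp_space_eq[OF sets_susp_measure]
    by (simp add: space_pair_measure space_restrict_space)
  ultimately have "integrable (susp_measure N \<tau>) g"
    using bound by (intro S.integrable_const_bound[of _ C]) auto
  then have int: "integrable ?P (\<lambda>z. ?d z *\<^sub>R g z)"
    unfolding susp_measure_eq_density using d g by (subst (asm) integrable_density) auto
  have "(\<integral>z. g z \<partial>susp_measure N \<tau>) = (\<integral>z. ?d z *\<^sub>R g z \<partial>?P)"
    unfolding susp_measure_eq_density using d g by (intro integral_density) auto
  also have "\<dots> = (\<integral>p. (\<integral>s. ?d (p, s) *\<^sub>R g (p, s) \<partial>restrict_space lborel {0..}) \<partial>N)"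
    by (rule integral_fst'[OF int, symmetric])
  also have "\<dots> = (\<integral>p. ?k * (LINT s:{0..\<tau> p}|lborel. g (p, s)) \<partial>N)"
  proof (rule Bochner_Integration.integral_cong[OF refl])
    fix p
    have "(\<integral>s. ?d (p, s) *\<^sub>R g (p, s) \<partial>restrict_space lborel {0..}) =
        (\<integral>s. ?k * (indicator {0..<\<tau> p} s * g (p, s)) \<partial>lborel)"
    proof (subst integral_restrict_space)
      show "(\<integral>s. indicator {0..} s *\<^sub>R (?d (p, s) *\<^sub>R g (p, s)) \<partial>lborel) =
          (\<integral>s. ?k * (indicator {0..<\<tau> p} s * g (p, s)) \<partial>lborel)"
        by (rule Bochner_Integration.integral_cong) (auto simp: indicator_def)
    qed simp
    also have "\<dots> = ?k * (\<integral>s. indicator {0..<\<tau> p} s * g (p, s) \<partial>lborel)"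
      by simp
    also have "(\<integral>s. indicator {0..<\<tau> p} s * g (p, s) \<partial>lborel) =
        (LINT s:{0..\<tau> p}|lborel. g (p, s))"
      unfolding set_lebesgue_integral_def
      by (rule integral_discrete_difference[of "{\<tau> p}"]) (auto simp: indicator_def)
    finally show "(\<integral>s. ?d (p, s) *\<^sub>R g (p, s) \<partial>restrict_space lborel {0..}) =
        ?k * (LINT s:{0..\<tau> p}|lborel. g (p, s))" .
  qed
  finally show ?thesis
    by simp
qed

text \<open>The base and the roof of the suspension are null; they are the places where cutting off near
  the section cannot be made harmless pointwise.\<close>

lemma AE_susp_measure:
  assumes "sigma_finite_measure N" and [measurable]: "\<tau> \<in> borel_measurable N"
  shows "AE z in susp_measure N \<tau>. 0 < snd z \<and> snd z < \<tau> (fst z)"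
proof -
  interpret pair_sigma_finite N "restrict_space lborel {0::real..}"
    using assms(1) sigma_finite_halfline by (rule pair_sigma_finite.intro)
  let ?P = "N \<Otimes>\<^sub>M restrict_space lborel {0::real..}"
  have [measurable]: "snd \<in> borel_measurable ?P"
    using measurable_snd[of N "restrict_space lborel {0::real..}"]
    by (auto simp: measurable_restrict_space2_iff)
  have "{z \<in> space ?P. snd z \<noteq> 0} \<in> sets ?P"
    by measurable
  moreover have "AE p in N. AE s in restrict_space lborel {0::real..}. snd (p, s) \<noteq> 0"
    using AE_lborel_singleton[of "0::real"] by (auto simp: AE_restrict_space_iff)
  ultimately have "AE z in ?P. snd z \<noteq> 0"
    by (rule AE_pair_measure)
  then show ?thesis
    unfolding susp_measure_eq_density
    by (subst AE_density)
      (auto intro!: borel_measurable_susp_density measurable_compose[OF _ measurable_ennreal]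
        simp: indicator_def elim!: eventually_mono)
qed

text \<open>Exchange of limits: the approximation of \<^term>\<open>A\<close> is uniform near the limit of
  \<^term>\<open>F\<close> because its error is bounded by quantities that converge along \<^term>\<open>F\<close> themselves.\<close>

lemma tendsto_if_approximable:
  fixes A :: "'i \<Rightarrow> real" and a :: real and A' H :: "nat \<Rightarrow> 'i \<Rightarrow> real"
  assumes "\<And>n. (A' n \<longlongrightarrow> a' n) F" "\<And>n. (H n \<longlongrightarrow> h n) F"
    and close: "\<And>n. \<forall>\<^sub>F i in F. \<bar>A i - A' n i\<bar> \<le> H n i"
    and "a' \<longlonglongrightarrow> a" "h \<longlonglongrightarrow> 0"
  shows "(A \<longlongrightarrow> a) F"
proof (rule tendstoI)
  fix e :: real assume "0 < e"
  then have e4: "0 < e / 4"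
    by simp
  have "\<forall>\<^sub>F n in sequentially. dist (a' n) a < e / 4 \<and> dist (h n) 0 < e / 4"
    using tendstoD[OF assms(4) e4] tendstoD[OF assms(5) e4] by eventually_elim simp
  then obtain n where n: "dist (a' n) a < e / 4" "dist (h n) 0 < e / 4"
    by (auto simp: eventually_sequentially)
  from tendstoD[OF assms(1)[of n] e4] tendstoD[OF assms(2)[of n] e4] close[of n]
  show "\<forall>\<^sub>F i in F. dist (A i) a < e"
  proof eventually_elim
    case (elim i)
    then show ?case
      using n unfolding dist_real_def by linarith
  qed
qed

section \<open>The random suspension\<close>

lemma continuous_on_noise_coordinate:
  fixes f :: "'a::topological_space \<Rightarrow> noise"
  shows "continuous_on A f \<Longrightarrow> continuous_on A (\<lambda>x. f x n)"
  by (rule continuous_on_product_then_coordinatewise)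

lemma continuous_on_noise_shift: "continuous_on A noise_shift"
  unfolding noise_shift_def[abs_def]
  by (rule continuous_on_coordinatewise_then_product) (intro continuous_on_noise_coordinate continuous_on_id)

locale random_suspension = return_family +
  fixes U :: "vec3 set"
  assumes zero_in_E: "0 \<in> E" and E_subset: "E \<subseteq> {-1..1}"
    and section_in_U: "M \<subseteq> U"
    and trapping: "\<eta> \<in> E \<Longrightarrow> 0 \<le> t \<Longrightarrow> \<Phi> \<eta> t ` U \<subseteq> U"
begin

abbreviation "base \<equiv> M \<times> seqs E"
abbreviation "regular \<equiv> skew_dom M E \<Gamma>"

lemma continuous_on_random_rate:
  "continuous_on base (\<lambda>p. return_rate (snd p 0, fst p))"
proof (rule continuous_on_compose2[OF continuous_on_return_rate])
  show "continuous_on base (\<lambda>p. (snd p 0, fst p))"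
    by (intro continuous_on_Pair continuous_on_noise_coordinate continuous_on_fst continuous_on_snd
        continuous_on_id)
qed (auto simp: seqs_def)

lemma random_rate_eq:
  "p \<in> base \<Longrightarrow> return_rate (snd p 0, fst p) = (if p \<in> regular then inverse (roof \<Phi> M p) else 0)"
  by (auto simp: return_rate_def skew_dom_def roof_def)

lemma continuous_on_random_flow:
  "continuous_on (base \<times> {0..}) (\<lambda>z. \<Phi> (snd (fst z) 0) (snd z) (fst (fst z)))"
proof -
  have "continuous_on (base \<times> {0..}) (\<lambda>z. (snd (fst z) 0, snd z, fst (fst z)))"
    by (intro continuous_on_Pair continuous_on_noise_coordinate continuous_on_fst continuous_on_snd
        continuous_on_id)
  moreover have "(\<lambda>z. (snd (fst z) 0, snd z, fst (fst z))) ` (base \<times> {0..}) \<subseteq> E \<times> {0..} \<times> UNIV"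
    by (auto simp: seqs_def)
  ultimately have "continuous_on (base \<times> {0..})
      (\<lambda>z. case (snd (fst z) 0, snd z, fst (fst z)) of (\<eta>, t, x) \<Rightarrow> \<Phi> \<eta> t x)"
    by (rule continuous_on_compose2[OF continuous_on_flow])
  then show ?thesis
    by simp
qed

lemma shift_in_seqs: "\<omega> \<in> seqs A \<Longrightarrow> noise_shift \<omega> \<in> seqs A"
  by (simp add: seqs_def noise_shift_def)

lemma rand_R_eq: "rand_R \<Phi> M p = (\<Phi> (snd p 0) (roof \<Phi> M p) (fst p), noise_shift (snd p))"
  by (simp add: rand_R_def skew_def return_map_def roof_def case_prod_beta)

sublocale susp: suspension base regular "roof \<Phi> M" "rand_R \<Phi> M" c
proof
  show "regular \<subseteq> base"
    by (auto simp: skew_dom_def)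
  show ge: "c \<le> roof \<Phi> M p" if "p \<in> regular" for p
    using that return_time_ge by (auto simp: skew_dom_def roof_def seqs_def)
  show "rand_R \<Phi> M p \<in> base" if "p \<in> regular" for p
  proof -
    obtain x \<omega> where p: "p = (x, \<omega>)" by force
    then have "\<omega> 0 \<in> E" "x \<in> M - \<Gamma> (\<omega> 0)" "\<omega> \<in> seqs E"
      using that by (auto simp: skew_dom_def seqs_def)
    then show ?thesis
      using return_map_in_section[of "\<omega> 0" x] shift_in_seqs[of \<omega> E]
      by (auto simp: p rand_R_eq roof_def surface_interior_def)
  qed
  show "0 < c"
    by (rule c_pos)
  show rate: "continuous_on base (\<lambda>p. if p \<in> regular then inverse (roof \<Phi> M p) else 0)"
    using continuous_on_random_rate by (rule continuous_on_eq) (rule random_rate_eq)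
  have "continuous_on regular (\<lambda>p. inverse (if p \<in> regular then inverse (roof \<Phi> M p) else 0))"
    using c_pos ge
    by (intro continuous_on_inverse continuous_on_subset[OF rate]) (fastforce simp: skew_dom_def)+
  then have "continuous_on regular (roof \<Phi> M)"
    by (rule continuous_on_eq) simp
  then have "continuous_on regular (\<lambda>p. (p, roof \<Phi> M p))"
    by (intro continuous_intros)
  moreover have "(\<lambda>p. (p, roof \<Phi> M p)) ` regular \<subseteq> base \<times> {0..}"
    using ge c_pos by (fastforce simp: skew_dom_def)
  ultimately have "continuous_on regular (\<lambda>p. \<Phi> (snd (fst (p, roof \<Phi> M p)) 0)
      (snd (p, roof \<Phi> M p)) (fst (fst (p, roof \<Phi> M p))))"
    by (rule continuous_on_compose2[OF continuous_on_random_flow])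
  then have "continuous_on regular (\<lambda>p. \<Phi> (snd p 0) (roof \<Phi> M p) (fst p))"
    by simp
  then show "continuous_on regular (rand_R \<Phi> M)"
    unfolding rand_R_eq[abs_def]
    by (intro continuous_on_Pair continuous_on_compose2[OF continuous_on_noise_shift[of UNIV]]
        continuous_on_snd continuous_on_id) auto
qed

lemma topspace_\<VV>: "topspace (\<VV>_topology \<Phi> M E \<Gamma>) = susp_space base regular (roof \<Phi> M)"
  by (simp add: \<VV>_topology_def susp.topspace_susp_topology)

lemma seqs_E_subset: "seqs E \<subseteq> \<Omega>"
  using E_subset by (auto simp: seqs_def)

lemma random_flow_in_U:
  assumes "x \<in> M" "\<omega> \<in> seqs E" "0 \<le> s"
  shows "\<Phi> (\<omega> 0) s x \<in> U"
  using trapping[of "\<omega> 0" s] assms section_in_U by (auto simp: seqs_def)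

lemma rand_V_in: "z \<in> base \<times> {0..} \<Longrightarrow> rand_V \<Phi> z \<in> U \<times> \<Omega>"
  using random_flow_in_U seqs_E_subset by (auto simp: rand_V_def)

lemma continuous_on_rand_V: "continuous_on (base \<times> {0..}) (rand_V \<Phi>)"
proof -
  have "continuous_on (base \<times> {0..}) (\<lambda>z. (\<Phi> (snd (fst z) 0) (snd z) (fst (fst z)), snd (fst z)))"
    by (intro continuous_intros continuous_on_random_flow)
  then show ?thesis
    by (simp add: rand_V_def case_prod_beta)
qed

text \<open>\<open>\<VV>\<close> carries the noise of the current excursion, so \<open>rand_V \<Phi>\<close> jumps from \<open>\<omega>\<close> to its shift
  when an orbit returns. The weight falls from 1 to 0 just below the roof, over a fraction
  \<^term>\<open>1 / real (Suc n)\<close> of its height, and \<open>blend\<close> uses it to pass continuously to the value with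
  the shifted noise. The function \<open>gap\<close> dominates the error of \<open>blend\<close>; its bump above the base makes it
  continuous across returns as well.\<close>

definition weight :: "nat \<Rightarrow> (vec3 \<times> noise) \<times> real \<Rightarrow> real" where
  "weight n z = max 0 (min 1 (real (Suc n) * (1 - snd z * return_rate (snd (fst z) 0, fst (fst z)))))"

definition blend :: "(vec3 \<times> noise \<Rightarrow> real) \<Rightarrow> nat \<Rightarrow> (vec3 \<times> noise) \<times> real \<Rightarrow> real" where
  "blend f n z = weight n z * f (rand_V \<Phi> z)
     + (1 - weight n z) * f (fst (rand_V \<Phi> z), noise_shift (snd (rand_V \<Phi> z)))"

definition gap :: "nat \<Rightarrow> (vec3 \<times> noise) \<times> real \<Rightarrow> real" where
  "gap n z = max (1 - weight n z) (1 - real (Suc n) * snd z)"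

lemma weight_bounds: "0 \<le> weight n z" "weight n z \<le> 1"
  by (auto simp: weight_def)

lemma weight_at_roof: "p \<in> regular \<Longrightarrow> weight n (p, roof \<Phi> M p) = 0"
  using susp.roof_ge[of p] c_pos susp.D_subset random_rate_eq[of p] by (auto simp: weight_def)

lemma weight_at_base: "weight n (p, 0) = 1"
  by (simp add: weight_def)

lemma continuous_on_weight: "continuous_on (base \<times> {0..}) (weight n)"
  unfolding weight_def[abs_def]
  by (intro continuous_intros continuous_on_compose2[OF continuous_on_random_rate]) auto

lemma continuous_on_gap: "continuous_on (base \<times> {0..}) (gap n)"
  unfolding gap_def[abs_def] by (intro continuous_intros continuous_on_weight)

lemma continuous_on_blend:
  assumes f: "continuous_on (U \<times> \<Omega>) f"
  shows "continuous_on (base \<times> {0..}) (blend f n)"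
proof -
  have "continuous_on (base \<times> {0..}) (\<lambda>z. f (rand_V \<Phi> z))"
    by (rule continuous_on_compose2[OF f continuous_on_rand_V]) (use rand_V_in in blast)
  moreover have "continuous_on (base \<times> {0..})
      (\<lambda>z. f (fst (rand_V \<Phi> z), noise_shift (snd (rand_V \<Phi> z))))"
  proof (rule continuous_on_compose2[OF f])
    show "continuous_on (base \<times> {0..}) (\<lambda>z. (fst (rand_V \<Phi> z), noise_shift (snd (rand_V \<Phi> z))))"
      by (intro continuous_on_Pair continuous_on_compose2[OF continuous_on_noise_shift[of UNIV]]
          continuous_on_fst continuous_on_snd continuous_on_rand_V) auto
    show "(\<lambda>z. (fst (rand_V \<Phi> z), noise_shift (snd (rand_V \<Phi> z)))) ` (base \<times> {0..}) \<subseteq> U \<times> \<Omega>"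
      using rand_V_in shift_in_seqs by (fastforce simp: mem_Times_iff)
  qed
  ultimately show ?thesis
    unfolding blend_def[abs_def] by (intro continuous_intros continuous_on_weight)
qed

lemma gap_glue: "p \<in> regular \<Longrightarrow> gap n (p, roof \<Phi> M p) = gap n (rand_R \<Phi> M p, 0)"
  using susp.roof_ge[of p] c_pos by (auto simp: gap_def weight_at_roof weight_at_base)

lemma blend_glue:
  assumes "p \<in> regular"
  shows "blend f n (p, roof \<Phi> M p) = blend f n (rand_R \<Phi> M p, 0)"
proof -
  have "snd (rand_R \<Phi> M p) 0 \<in> E"
    using susp.F_into[OF assms] by (auto simp: seqs_def)
  then show ?thesis
    by (simp add: blend_def weight_at_roof[OF assms] weight_at_base rand_V_def case_prod_beta flow_0)
      (simp add: rand_R_eq)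
qed

lemma gap_bounds: "0 \<le> gap n z" "z \<in> base \<times> {0..} \<Longrightarrow> gap n z \<le> 1"
  using weight_bounds[of n z] by (auto simp: gap_def le_max_iff_disj)

lemma shifted_in:
  "z \<in> base \<times> {0..} \<Longrightarrow> (fst (rand_V \<Phi> z), noise_shift (snd (rand_V \<Phi> z))) \<in> U \<times> \<Omega>"
  using rand_V_in[of z] shift_in_seqs by (auto simp: mem_Times_iff)

lemma blend_bound:
  assumes C: "\<And>y. y \<in> U \<times> \<Omega> \<Longrightarrow> \<bar>f y\<bar> \<le> C" and z: "z \<in> base \<times> {0..}"
  shows "\<bar>blend f n z\<bar> \<le> C"
proof -
  let ?w = "weight n z"
  have "\<bar>blend f n z\<bar> \<le> ?w * \<bar>f (rand_V \<Phi> z)\<bar>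
      + (1 - ?w) * \<bar>f (fst (rand_V \<Phi> z), noise_shift (snd (rand_V \<Phi> z)))\<bar>"
    unfolding blend_def using weight_bounds[of n z]
    by (intro order_trans[OF abs_triangle_ineq]) (simp add: abs_mult)
  also have "\<dots> \<le> ?w * C + (1 - ?w) * C"
    using weight_bounds[of n z] C[OF rand_V_in[OF z]] C[OF shifted_in[OF z]]
    by (intro add_mono mult_left_mono) auto
  finally show ?thesis
    by (simp add: algebra_simps)
qed

lemma blend_error:
  assumes C: "\<And>y. y \<in> U \<times> \<Omega> \<Longrightarrow> \<bar>f y\<bar> \<le> C" and z: "z \<in> base \<times> {0..}"
  shows "\<bar>f (rand_V \<Phi> z) - blend f n z\<bar> \<le> 2 * C * gap n z"
proof -
  let ?d = "f (rand_V \<Phi> z) - f (fst (rand_V \<Phi> z), noise_shift (snd (rand_V \<Phi> z)))"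
  have "f (rand_V \<Phi> z) - blend f n z = (1 - weight n z) * ?d"
    by (simp add: blend_def algebra_simps)
  also have "\<bar>\<dots>\<bar> = (1 - weight n z) * \<bar>?d\<bar>"
    using weight_bounds[of n z] by (simp add: abs_mult)
  also have "\<dots> \<le> gap n z * (2 * C)"
    using weight_bounds[of n z] C[OF rand_V_in[OF z]] C[OF shifted_in[OF z]]
    by (intro mult_mono) (auto simp: gap_def)
  finally show ?thesis
    by (simp add: mult.commute)
qed

lemma eventually_weight_eq_1:
  assumes "z \<in> susp_space base regular (roof \<Phi> M)"
  shows "\<forall>\<^sub>F n in sequentially. weight n z = 1"
proof -
  let ?a = "1 - snd z * return_rate (snd (fst z) 0, fst (fst z))"
  have "fst z \<in> base" "0 < ?a"
    using assms random_rate_eq[of "fst z"] susp.mem_susp_space_iff[of "fst z" "snd z"]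
    by (auto simp: susp.rate_def)
  obtain N where N: "1 < real N * ?a"
    using reals_Archimedean3[OF \<open>0 < ?a\<close>] by blast
  show ?thesis
  proof (rule eventually_sequentiallyI[of N])
    fix n assume "N \<le> n"
    then have "real N * ?a \<le> real (Suc n) * ?a"
      using \<open>0 < ?a\<close> by (intro mult_right_mono) auto
    then have "1 \<le> real (Suc n) * ?a"
      using N by linarith
    then show "weight n z = 1"
      unfolding weight_def by linarith
  qed
qed

lemma blend_tendsto:
  assumes "z \<in> susp_space base regular (roof \<Phi> M)"
  shows "(\<lambda>n. blend f n z) \<longlonglongrightarrow> f (rand_V \<Phi> z)"
  by (rule tendsto_eventually, rule eventually_mono[OF eventually_weight_eq_1[OF assms]])
    (simp add: blend_def)

lemma gap_tendsto:
  assumes "z \<in> susp_space base regular (roof \<Phi> M)" "0 < snd z"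
  shows "(\<lambda>n. gap n z) \<longlonglongrightarrow> 0"
proof -
  obtain N where N: "1 < real N * snd z"
    using reals_Archimedean3[OF assms(2)] by blast
  have "\<forall>\<^sub>F n in sequentially. 1 \<le> real (Suc n) * snd z"
  proof (rule eventually_sequentiallyI[of N])
    fix n assume "N \<le> n"
    then have "real N * snd z \<le> real (Suc n) * snd z"
      using assms(2) by (intro mult_right_mono) auto
    then show "1 \<le> real (Suc n) * snd z"
      using N by linarith
  qed
  then have "\<forall>\<^sub>F n in sequentially. gap n z = 0"
    using eventually_weight_eq_1[OF assms(1)] by eventually_elim (simp add: gap_def)
  then show ?thesis
    by (rule tendsto_eventually)
qed

text \<open>The functions \<open>blend f n\<close> are continuous on the suspension and converge pointwise to
  \<open>f \<circ> rand_V \<Phi>\<close>. Distance functions in place of \<open>f\<close> then give the preimages of open sets.\<close>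

lemma rand_V_measurable:
  assumes N: "sets N = sets (borel_of (\<VV>_topology \<Phi> M E \<Gamma>))"
  shows "rand_V \<Phi> \<in> N \<rightarrow>\<^sub>M restrict_space borel (U \<times> \<Omega>)"
proof (rule measurable_restrict_space2)
  have "space (borel_of X) = topspace X" for X :: "((vec3 \<times> noise) \<times> real) topology"
    by (simp add: borel_of_def space_measure_of_conv)
  then have sp: "space N = susp_space base regular (roof \<Phi> M)"
    using sets_eq_imp_space_eq[OF N] topspace_\<VV> by simp
  have below: "z \<in> base \<times> {0..}" if "z \<in> space N" for z
    using that by (auto simp: sp susp_space_def susp_cover_def)
  then show "rand_V \<Phi> \<in> space N \<rightarrow> U \<times> \<Omega>"
    using rand_V_in by blast
  have real: "(\<lambda>z. f (rand_V \<Phi> z)) \<in> borel_measurable N"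
    if f: "continuous_on UNIV f" for f :: "vec3 \<times> noise \<Rightarrow> real"
  proof (rule borel_measurable_LIMSEQ_real)
    show "(\<lambda>n. blend f n z) \<longlonglongrightarrow> f (rand_V \<Phi> z)" if "z \<in> space N" for z
      using blend_tendsto that sp by simp
    show "blend f n \<in> borel_measurable N" for n
      using N continuous_on_blend[OF continuous_on_subset[OF f]] blend_glue
      by (intro measurable_borel_of[where X = "\<VV>_topology \<Phi> M E \<Gamma>"])
        (auto simp: \<VV>_topology_def intro: susp.continuous_map_susp_topology)
  qed
  show "rand_V \<Phi> \<in> borel_measurable N"
  proof (rule borel_measurableI)
    fix W :: "(vec3 \<times> noise) set" assume "open W"
    show "rand_V \<Phi> -` W \<inter> space N \<in> sets N"
    proof (cases "W = UNIV")
      case False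
      let ?f = "\<lambda>y. infdist y (- W)"
      have [measurable]: "(\<lambda>z. ?f (rand_V \<Phi> z)) \<in> borel_measurable N"
        by (intro real continuous_intros)
      have iff: "y \<in> W \<longleftrightarrow> 0 < ?f y" for y
        using in_closed_iff_infdist_zero[of "- W" y] \<open>open W\<close> False infdist_nonneg[of y "- W"]
        by (auto simp: less_le)
      then have "rand_V \<Phi> -` W \<inter> space N = {z \<in> space N. 0 < ?f (rand_V \<Phi> z)}"
        unfolding set_eq_iff Int_iff vimage_eq mem_Collect_eq iff by blast
      then show ?thesis
        by simp
    qed simp
  qed
qed

end

section \<open>Passing to the limit\<close>

context random_suspension begin

lemma zero_noise_in: "zero_noise \<in> seqs E"
  using zero_in_E by (simp add: seqs_def zero_noise_def)

lemma zero_noise_section: "x \<in> M \<Longrightarrow> 0 \<le> s \<Longrightarrow> ((x, zero_noise), s) \<in> base \<times> {0..}"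
  using zero_noise_in by auto

lemma continuous_on_zero_noise_slice:
  assumes "continuous_on (base \<times> {0..}) G"
  shows "continuous_on (M \<times> {0..}) (\<lambda>(x, s). G ((x, zero_noise), s))"
proof -
  have "continuous_on (M \<times> {0..}) (\<lambda>z. ((fst z, zero_noise), snd z))"
    by (intro continuous_intros)
  then have "continuous_on (M \<times> {0..}) (\<lambda>z. G ((fst z, zero_noise), snd z))"
    by (rule continuous_on_compose2[OF assms]) (use zero_noise_in in auto)
  then show ?thesis
    by (simp add: case_prod_beta)
qed

text \<open>For a test function given by gluing, stochastic stability says that the integrals converge to
  the integral against the unperturbed suspension measure. If the total unperturbed roof is not
  positive (on the singular leaf the return time is the infimum of the empty set, an arbitrary real
  number), that measure vanishes; then the test function 1 shows that the total masses of
  the random suspension measures tend to 0, as their limit is at most 0.\<close>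

lemma stable_glued_limit:
  fixes G :: "(vec3 \<times> noise) \<times> real \<Rightarrow> real"
  assumes stable: "stochastically_stable \<Phi> M E \<Gamma> \<mu>S N"
    and N: "prob_space N" "sets N = sets (restrict_space borel M)"
    and \<tau>: "integrable N (return_time (\<Phi> 0) M)"
    and \<mu>S: "\<forall>\<^sub>F \<epsilon> in at_right 0. finite_measure (\<mu>S \<epsilon>) \<and>
      sets (\<mu>S \<epsilon>) = sets (borel_of (\<VV>_topology \<Phi> M E \<Gamma>))"
    and G: "continuous_on (base \<times> {0..}) G"
    and glue: "\<And>p. p \<in> regular \<Longrightarrow> G (p, roof \<Phi> M p) = G (rand_R \<Phi> M p, 0)"
    and bound: "\<And>z. z \<in> base \<times> {0..} \<Longrightarrow> \<bar>G z\<bar> \<le> C"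
  shows "((\<lambda>\<epsilon>. \<integral>z. G z \<partial>\<mu>S \<epsilon>) \<longlongrightarrow>
    (\<integral>(x, s). G ((x, zero_noise), s) \<partial>susp_measure N (return_time (\<Phi> 0) M))) (at_right 0)"
proof -
  let ?\<tau> = "return_time (\<Phi> 0) M"
  let ?m = "\<integral>x. ?\<tau> x \<partial>N"
  let ?I = "\<lambda>G :: (vec3 \<times> noise) \<times> real \<Rightarrow> real. \<integral>x. (LINT s:{0..?\<tau> x}|lborel. G ((x, zero_noise), s)) \<partial>N"
  interpret N: prob_space N
    by (rule N(1))
  have spN: "space N = M"
    using sets_eq_imp_space_eq[OF N(2)] by (simp add: space_restrict_space)
  have sp: "z \<in> base \<times> {0..}" if "z \<in> topspace (\<VV>_topology \<Phi> M E \<Gamma>)" for z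
    using that by (auto simp: topspace_\<VV> susp_space_def susp_cover_def)
  have limit: "((\<lambda>\<epsilon>. \<integral>z. G z \<partial>\<mu>S \<epsilon>) \<longlongrightarrow> (1 / ?m) * ?I G) (at_right 0)"
    if G: "continuous_on (base \<times> {0..}) G"
      and glue: "\<And>p. p \<in> regular \<Longrightarrow> G (p, roof \<Phi> M p) = G (rand_R \<Phi> M p, 0)"
      and bound: "\<And>z. z \<in> base \<times> {0..} \<Longrightarrow> \<bar>G z\<bar> \<le> C"
    for G :: "(vec3 \<times> noise) \<times> real \<Rightarrow> real" and C
  proof -
    have "bounded_continuous (\<VV>_topology \<Phi> M E \<Gamma>) G"
      unfolding bounded_continuous_def
    proof
      show "continuous_map (\<VV>_topology \<Phi> M E \<Gamma>) euclideanreal G"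
        unfolding \<VV>_topology_def by (rule susp.continuous_map_susp_topology[OF G glue])
      show "bounded (G ` topspace (\<VV>_topology \<Phi> M E \<Gamma>))"
        using sp bound by (auto simp: bounded_iff intro!: exI[of _ C])
    qed
    then have "((\<lambda>\<epsilon>. \<integral>z. G z \<partial>\<mu>S \<epsilon>) \<longlongrightarrow> (1 / ?m) *
        (\<integral>x. (LINT s:{0..?\<tau> x}|lborel. G (\<VV>_proj \<Phi> M E \<Gamma> ((x, zero_noise), s))) \<partial>N)) (at_right 0)"
      using stable unfolding stochastically_stable_def Let_def by blast
    moreover have "(\<integral>x. (LINT s:{0..?\<tau> x}|lborel. G (\<VV>_proj \<Phi> M E \<Gamma> ((x, zero_noise), s))) \<partial>N) = ?I G"
    proof (rule Bochner_Integration.integral_cong[OF refl])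
      fix x assume "x \<in> space N"
      then have x: "(x, zero_noise) \<in> base"
        using spN zero_noise_in by simp
      have "G (\<VV>_proj \<Phi> M E \<Gamma> ((x, zero_noise), s)) = G ((x, zero_noise), s)" if "s \<in> {0..?\<tau> x}" for s
        unfolding \<VV>_proj_def using that x
        by (intro susp.glued_value[of G, OF glue]) (auto simp: roof_def zero_noise_def)
      then show "(LINT s:{0..?\<tau> x}|lborel. G (\<VV>_proj \<Phi> M E \<Gamma> ((x, zero_noise), s))) =
          (LINT s:{0..?\<tau> x}|lborel. G ((x, zero_noise), s))"
        by (intro set_lebesgue_integral_cong) auto
    qed
    ultimately show ?thesis
      by simp
  qed
  have unperturbed: "(\<integral>(x, s). G ((x, zero_noise), s) \<partial>susp_measure N ?\<tau>) = max 0 (1 / ?m) * ?I G"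
  proof (subst integral_susp_measure[OF N.sigma_finite_measure_axioms \<tau>, where C = C])
    show "(\<lambda>(x, s). G ((x, zero_noise), s)) \<in> borel_measurable (N \<Otimes>\<^sub>M restrict_space lborel {0..})"
      by (rule borel_measurable_continuous_on_Times_halfline[OF continuous_on_zero_noise_slice[OF G] N(2)])
    show "\<bar>case z of (x, s) \<Rightarrow> G ((x, zero_noise), s)\<bar> \<le> C" if "z \<in> space N \<times> {0..}" for z
      using that spN zero_noise_section[of "fst z" "snd z"] bound[of "((fst z, zero_noise), snd z)"]
      by (simp add: case_prod_beta mem_Times_iff)
  qed simp
  show ?thesis
  proof (cases "0 < ?m")
    case True
    then have "max 0 (1 / ?m) = 1 / ?m"
      by simp
    then show ?thesis
      using limit[OF G glue bound] unperturbed by simp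
  next
    case False
    have mass: "((\<lambda>\<epsilon>. \<integral>z. 1 \<partial>\<mu>S \<epsilon>) \<longlongrightarrow> (1 / ?m) * ?I (\<lambda>z. 1)) (at_right 0)"
      by (rule limit[of "\<lambda>z. 1" 1]) auto
    have "0 \<le> ?I (\<lambda>z. 1)"
      unfolding set_lebesgue_integral_def
      by (rule Bochner_Integration.integral_nonneg, rule Bochner_Integration.integral_nonneg) simp
    then have "(1 / ?m) * ?I (\<lambda>z. 1) \<le> 0"
      using False by (intro mult_nonpos_nonneg) auto
    moreover have "0 \<le> (1 / ?m) * ?I (\<lambda>z. 1)"
      by (rule tendsto_lowerbound[OF mass]) (auto simp: trivial_limit_at_right_real)
    ultimately have zero: "(1 / ?m) * ?I (\<lambda>z. 1) = 0"
      by (rule antisym)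
    have mass0: "((\<lambda>\<epsilon>. C * (\<integral>z. 1 \<partial>\<mu>S \<epsilon>)) \<longlongrightarrow> C * 0) (at_right 0)"
      using mass unfolding zero by (rule tendsto_mult_left)
    have "((\<lambda>\<epsilon>. \<integral>z. G z \<partial>\<mu>S \<epsilon>) \<longlongrightarrow> 0) (at_right 0)"
    proof (rule Lim_null_comparison[OF _ mass0[simplified]])
      show "\<forall>\<^sub>F \<epsilon> in at_right 0. norm (\<integral>z. G z \<partial>\<mu>S \<epsilon>) \<le> C * measure (\<mu>S \<epsilon>) (space (\<mu>S \<epsilon>))"
        using \<mu>S
      proof eventually_elim
        case (elim \<epsilon>)
        then interpret S: finite_measure "\<mu>S \<epsilon>" by simp
        have "space (\<mu>S \<epsilon>) = topspace (\<VV>_topology \<Phi> M E \<Gamma>)"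
          using elim sets_eq_imp_space_eq[of "\<mu>S \<epsilon>" "borel_of (\<VV>_topology \<Phi> M E \<Gamma>)"]
          by (simp add: borel_of_def space_measure_of_conv)
        then have b: "norm (G z) \<le> C" if "z \<in> space (\<mu>S \<epsilon>)" for z
          using that sp bound by simp
        have "norm (\<integral>z. G z \<partial>\<mu>S \<epsilon>) \<le> (\<integral>z. norm (G z) \<partial>\<mu>S \<epsilon>)"
          by (rule integral_norm_bound)
        also have "\<dots> \<le> (\<integral>z. C \<partial>\<mu>S \<epsilon>)"
        proof (rule integral_mono')
          show "norm (G z) \<le> C" "0 \<le> C" if "z \<in> space (\<mu>S \<epsilon>)" for z
            using b[OF that] order_trans[OF norm_ge_zero b[OF that]] by auto
        qed simp
        finally show ?case
          by (simp add: mult.commute)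
      qed
    qed
    moreover have "max 0 (1 / ?m) = 0"
      using False by simp
    ultimately show ?thesis
      using unperturbed by simp
  qed
qed

text \<open>The unperturbed integrals of \<open>blend f n\<close> and \<open>gap n\<close> converge as \<open>n\<close> tends to infinity by
  dominated convergence, since almost every point lies strictly between base and roof.\<close>

lemma weak_limit_of_flow:
  fixes f :: "vec3 \<times> noise \<Rightarrow> real"
  assumes stable: "stochastically_stable \<Phi> M E \<Gamma> \<mu>S N"
    and N: "prob_space N" "sets N = sets (restrict_space borel M)"
    and \<tau>: "integrable N (return_time (\<Phi> 0) M)"
    and \<mu>S: "\<forall>\<^sub>F \<epsilon> in at_right 0. finite_measure (\<mu>S \<epsilon>) \<and>
      sets (\<mu>S \<epsilon>) = sets (borel_of (\<VV>_topology \<Phi> M E \<Gamma>))"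
    and f: "continuous_on (U \<times> \<Omega>) f" and C: "\<And>y. y \<in> U \<times> \<Omega> \<Longrightarrow> \<bar>f y\<bar> \<le> C"
  shows "((\<lambda>\<epsilon>. \<integral>z. f (rand_V \<Phi> z) \<partial>\<mu>S \<epsilon>) \<longlongrightarrow>
    (\<integral>(x, s). f (\<Phi> 0 s x, zero_noise) \<partial>susp_measure N (return_time (\<Phi> 0) M))) (at_right 0)"
proof -
  let ?\<nu> = "susp_measure N (return_time (\<Phi> 0) M)"
  let ?slice = "\<lambda>G (x, s). G ((x, zero_noise), s)"
  interpret N: prob_space N
    by (rule N(1))
  interpret \<nu>: finite_measure ?\<nu>
    by (rule finite_susp_measure[OF \<tau>])
  have spN: "space N = M"
    using sets_eq_imp_space_eq[OF N(2)] by (simp add: space_restrict_space)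
  have "space ?\<nu> = M \<times> {0..}"
    using sets_eq_imp_space_eq[OF sets_susp_measure, of N] spN
    by (simp add: space_pair_measure space_restrict_space)
  then have below: "AE z in ?\<nu>. ((fst z, zero_noise), snd z) \<in> base \<times> {0..}"
    using zero_noise_section by (intro AE_I2) auto
  have meas: "?slice G \<in> borel_measurable ?\<nu>" if "continuous_on (base \<times> {0..}) G"
    for G :: "_ \<Rightarrow> real"
    using borel_measurable_continuous_on_Times_halfline[OF continuous_on_zero_noise_slice[OF that] N(2)]
    by (simp add: measurable_cong_sets[OF sets_susp_measure refl])
  have inside: "AE z in ?\<nu>. ((fst z, zero_noise), snd z) \<in> susp_space base regular (roof \<Phi> M) \<and> 0 < snd z"
    using AE_susp_measure[OF N.sigma_finite_measure_axioms borel_measurable_integrable[OF \<tau>]] below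
  proof eventually_elim
    case (elim z)
    then show ?case
      by (auto simp: susp_space_def susp_cover_def roof_def zero_noise_def)
  qed
  have cont_fV: "continuous_on (base \<times> {0..}) (\<lambda>z. f (rand_V \<Phi> z))"
    by (rule continuous_on_compose2[OF f continuous_on_rand_V]) (use rand_V_in in blast)
  have C0: "0 \<le> C"
  proof -
    obtain z where "z \<in> M"
      using poincare[OF zero_in_E] by (auto simp: poincare_section_def compact_surface_def)
    then have "(z, zero_noise) \<in> U \<times> \<Omega>"
      using section_in_U seqs_E_subset zero_noise_in by auto
    from C[OF this] show ?thesis
      by (rule order_trans[OF abs_ge_zero])
  qed
  have blend_lim: "(\<lambda>n. \<integral>z. ?slice (blend f n) z \<partial>?\<nu>) \<longlonglongrightarrow> (\<integral>z. ?slice (\<lambda>z. f (rand_V \<Phi> z)) z \<partial>?\<nu>)"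
  proof (rule integral_dominated_convergence[where w = "\<lambda>_. C"])
    show "AE z in ?\<nu>. (\<lambda>n. ?slice (blend f n) z) \<longlonglongrightarrow> ?slice (\<lambda>z. f (rand_V \<Phi> z)) z"
      using inside by eventually_elim (simp add: blend_tendsto case_prod_beta)
    show "AE z in ?\<nu>. norm (?slice (blend f n) z) \<le> C" for n
      using below by eventually_elim (simp add: blend_bound[OF C] case_prod_beta del: mem_Sigma_iff)
  qed (auto intro!: meas continuous_on_blend f cont_fV)
  have gap_lim: "(\<lambda>n. \<integral>z. ?slice (\<lambda>z. 2 * C * gap n z) z \<partial>?\<nu>) \<longlonglongrightarrow> (\<integral>z. 0 \<partial>?\<nu>)"
  proof (rule integral_dominated_convergence[where w = "\<lambda>_. 2 * C"])
    show "AE z in ?\<nu>. (\<lambda>n. ?slice (\<lambda>z. 2 * C * gap n z) z) \<longlonglongrightarrow> 0"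
      using inside
      by eventually_elim (auto simp: case_prod_beta intro!: tendsto_mult_right_zero gap_tendsto)
    show "AE z in ?\<nu>. norm (?slice (\<lambda>z. 2 * C * gap n z) z) \<le> 2 * C" for n
      using below
    proof eventually_elim
      case (elim z)
      then show ?case
        using gap_bounds(1)[of n "((fst z, zero_noise), snd z)"]
          gap_bounds(2)[of "((fst z, zero_noise), snd z)" n] C0
        by (auto simp: case_prod_beta abs_mult intro!: mult_left_le)
    qed
  qed (auto intro!: meas continuous_intros continuous_on_gap)
  have blend_stable: "((\<lambda>\<epsilon>. \<integral>z. blend f n z \<partial>\<mu>S \<epsilon>) \<longlongrightarrow> (\<integral>z. ?slice (blend f n) z \<partial>?\<nu>)) (at_right 0)" for n
    using stable_glued_limit[OF stable N \<tau> \<mu>S continuous_on_blend[OF f] blend_glue blend_bound[OF C]]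
    by simp
  have gap_stable: "((\<lambda>\<epsilon>. \<integral>z. 2 * C * gap n z \<partial>\<mu>S \<epsilon>) \<longlongrightarrow> (\<integral>z. ?slice (\<lambda>z. 2 * C * gap n z) z \<partial>?\<nu>))
      (at_right 0)" for n
  proof (rule stable_glued_limit[OF stable N \<tau> \<mu>S, where C = "2 * C"])
    show "\<bar>2 * C * gap n z\<bar> \<le> 2 * C" if "z \<in> base \<times> {0..}" for z
      using gap_bounds(1)[of n z] gap_bounds(2)[of z n] that C0 by (auto simp: abs_mult intro!: mult_left_le)
  qed (auto intro!: continuous_intros continuous_on_gap simp: gap_glue)
  have close: "\<forall>\<^sub>F \<epsilon> in at_right 0. \<bar>(\<integral>z. f (rand_V \<Phi> z) \<partial>\<mu>S \<epsilon>) - (\<integral>z. blend f n z \<partial>\<mu>S \<epsilon>)\<bar>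
      \<le> (\<integral>z. 2 * C * gap n z \<partial>\<mu>S \<epsilon>)" for n
    using \<mu>S
  proof eventually_elim
    case (elim \<epsilon>)
    then interpret S: finite_measure "\<mu>S \<epsilon>" by simp
    have sets: "sets (\<mu>S \<epsilon>) = sets (borel_of (\<VV>_topology \<Phi> M E \<Gamma>))"
      using elim by simp
    then have "space (\<mu>S \<epsilon>) = susp_space base regular (roof \<Phi> M)"
      using sets_eq_imp_space_eq[OF sets] topspace_\<VV>
      by (simp add: borel_of_def space_measure_of_conv)
    then have sp: "z \<in> base \<times> {0..}" if "z \<in> space (\<mu>S \<epsilon>)" for z
      using that by (auto simp: susp_space_def susp_cover_def)
    have glued: "integrable (\<mu>S \<epsilon>) G"
      if "continuous_on (base \<times> {0..}) G" "\<And>p. p \<in> regular \<Longrightarrow> G (p, roof \<Phi> M p) = G (rand_R \<Phi> M p, 0)"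
        "\<And>z. z \<in> base \<times> {0..} \<Longrightarrow> \<bar>G z\<bar> \<le> K" for G :: "_ \<Rightarrow> real" and K
    proof (rule S.integrable_const_bound[of _ K])
      show "G \<in> borel_measurable (\<mu>S \<epsilon>)"
        using that(1,2) by (intro measurable_borel_of[OF _ sets])
          (auto simp: \<VV>_topology_def intro: susp.continuous_map_susp_topology)
    qed (use that(3) sp in auto)
    have iB: "integrable (\<mu>S \<epsilon>) (blend f n)"
      by (rule glued[OF continuous_on_blend[OF f] blend_glue blend_bound[OF C]])
    have iG: "integrable (\<mu>S \<epsilon>) (\<lambda>z. 2 * C * gap n z)"
      using gap_bounds
      by (intro integrable_mult_right glued[of "gap n" 1] continuous_on_gap gap_glue) auto
    have iF: "integrable (\<mu>S \<epsilon>) (\<lambda>z. f (rand_V \<Phi> z))"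
    proof (rule S.integrable_const_bound[of _ C])
      show "(\<lambda>z. f (rand_V \<Phi> z)) \<in> borel_measurable (\<mu>S \<epsilon>)"
        by (rule measurable_compose[OF rand_V_measurable[OF sets]
              borel_measurable_continuous_on_restrict[OF f]])
    qed (use C rand_V_in sp in auto)
    have "\<bar>(\<integral>z. f (rand_V \<Phi> z) \<partial>\<mu>S \<epsilon>) - (\<integral>z. blend f n z \<partial>\<mu>S \<epsilon>)\<bar>
        = \<bar>\<integral>z. f (rand_V \<Phi> z) - blend f n z \<partial>\<mu>S \<epsilon>\<bar>"
      using iF iB by simp
    also have "\<dots> \<le> (\<integral>z. \<bar>f (rand_V \<Phi> z) - blend f n z\<bar> \<partial>\<mu>S \<epsilon>)"
      by (rule integral_abs_bound)
    also have "\<dots> \<le> (\<integral>z. 2 * C * gap n z \<partial>\<mu>S \<epsilon>)"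
      by (rule integral_mono[OF integrable_abs[OF Bochner_Integration.integrable_diff[OF iF iB]] iG])
        (rule blend_error[OF C sp])
    finally show ?case .
  qed
  have "((\<lambda>\<epsilon>. \<integral>z. f (rand_V \<Phi> z) \<partial>\<mu>S \<epsilon>) \<longlongrightarrow>
      (\<integral>z. ?slice (\<lambda>z. f (rand_V \<Phi> z)) z \<partial>?\<nu>)) (at_right 0)"
    by (rule tendsto_if_approximable[OF blend_stable gap_stable close blend_lim])
      (use gap_lim in simp)
  then show ?thesis
    by (simp add: rand_V_def zero_noise_def case_prod_unfold)
qed

end

lemma integral_pair_return:
  fixes f :: "'a::second_countable_topology \<times> 'b::second_countable_topology \<Rightarrow> real"
  assumes "finite_measure N" and N: "sets N = sets (restrict_space borel A)" and "y \<in> B"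
    and f: "continuous_on (A \<times> B) f" and C: "\<And>z. z \<in> A \<times> B \<Longrightarrow> \<bar>f z\<bar> \<le> C"
  shows "(\<integral>z. f z \<partial>(N \<Otimes>\<^sub>M return (restrict_space borel B) y)) = (\<integral>x. f (x, y) \<partial>N)"
proof -
  let ?R = "return (restrict_space borel B) y"
  let ?P = "N \<Otimes>\<^sub>M ?R"
  interpret N: finite_measure N by fact
  interpret R: prob_space ?R
    using \<open>y \<in> B\<close> by (intro prob_space_return) (simp add: space_restrict_space)
  interpret pair_sigma_finite N ?R ..
  interpret P: finite_measure ?P
    by (rule finite_measure_pair_measure[OF R.finite_measure_axioms N.finite_measure_axioms])
  have spN: "space N = A"
    using sets_eq_imp_space_eq[OF N] by (simp add: space_restrict_space)
  have sp: "space ?P = A \<times> B"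
    by (simp add: space_pair_measure spN space_restrict_space)
  have "fst \<in> ?P \<rightarrow>\<^sub>M restrict_space borel A" "snd \<in> ?P \<rightarrow>\<^sub>M restrict_space borel B"
    using measurable_fst[of N ?R] measurable_snd[of N ?R]
    by (auto simp: measurable_cong_sets[OF refl N[symmetric]] measurable_cong_sets[OF refl sets_return])
  then have "fst \<in> ?P \<rightarrow>\<^sub>M borel" "snd \<in> ?P \<rightarrow>\<^sub>M borel"
    by (auto simp: measurable_restrict_space2_iff)
  then have "(\<lambda>z. (fst z, snd z)) \<in> ?P \<rightarrow>\<^sub>M borel"
    by (rule borel_measurable_Pair)
  then have "(\<lambda>z. z) \<in> ?P \<rightarrow>\<^sub>M restrict_space borel (A \<times> B)"
    using sp by (intro measurable_restrict_space2) auto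
  from measurable_compose[OF this borel_measurable_continuous_on_restrict[OF f]]
  have meas: "f \<in> borel_measurable ?P"
    by simp
  then have "integrable ?P f"
    using C sp by (intro P.integrable_const_bound[of _ C]) auto
  then have "(\<integral>z. f z \<partial>?P) = (\<integral>x. (\<integral>w. f (x, w) \<partial>?R) \<partial>N)"
    by (rule integral_fst'[symmetric])
  also have "\<dots> = (\<integral>x. f (x, y) \<partial>N)"
  proof (rule Bochner_Integration.integral_cong[OF refl])
    fix x assume "x \<in> space N"
    then have "(\<lambda>w. f (x, w)) \<in> borel_measurable (restrict_space borel B)"
      using spN by (intro borel_measurable_continuous_on_restrict continuous_on_compose2[OF f])
        (auto intro!: continuous_intros)
    then show "(\<integral>w. f (x, w) \<partial>?R) = f (x, y)"
      using \<open>y \<in> B\<close> by (intro integral_return) (auto simp: space_restrict_space)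
  qed
  finally show ?thesis .
qed

theorem proposition18:
  fixes r :: nat and \<epsilon>\<^sub>0 :: real and E :: "real set" and law :: "real \<Rightarrow> real measure"
    and \<phi> :: "real \<Rightarrow> vec3 \<Rightarrow> vec3" and \<Phi> :: "real \<Rightarrow> real \<Rightarrow> vec3 \<Rightarrow> vec3"
    and U M :: "vec3 set" and \<sigma> :: "real \<Rightarrow> vec3" and \<rho> :: "real \<Rightarrow> real" and \<Gamma> :: "real \<Rightarrow> vec3 set"
    and R :: "real \<Rightarrow> vec3 \<Rightarrow> vec3" and \<tau> :: "real \<Rightarrow> vec3 \<Rightarrow> real"
    and \<gamma> :: "real \<Rightarrow> real \<Rightarrow> vec3" and I :: "real \<Rightarrow> vec3 set"
    and q T \<kappa> \<iota> Rbar Tbar :: "real \<Rightarrow> vec3 \<Rightarrow> vec3"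
    and \<mu>T \<mu>Rbar \<mu>R :: "real \<Rightarrow> (vec3 \<times> noise) measure"
    and \<mu>S :: "real \<Rightarrow> ((vec3 \<times> noise) \<times> real) measure"
    and \<mu>V :: "real \<Rightarrow> (vec3 \<times> noise) measure"
    and \<mu>T0 \<mu>R0 \<mu>0 :: "vec3 measure" and \<mu>S0 :: "(vec3 \<times> real) measure"
  assumes noise_law:
      "\<epsilon>\<^sub>0 > 0" "0 \<in> E" "E \<subseteq> {-1..1}"
      "\<And>\<epsilon>. \<epsilon> \<in> {0<..<\<epsilon>\<^sub>0} \<Longrightarrow> prob_space (law \<epsilon>) \<and> sets (law \<epsilon>) = sets borel"
      "\<And>\<epsilon>. \<epsilon> \<in> {0<..<\<epsilon>\<^sub>0} \<Longrightarrow> measure_support (law \<epsilon>) \<subseteq> E \<inter> {-\<epsilon>..\<epsilon>}"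
      "weak_limit euclidean law (return borel 0) (at_right 0)"
    and fields:
      "2 \<le> r" "\<And>\<eta>. \<eta> \<in> E \<Longrightarrow> Ck_on r UNIV (\<phi> \<eta>)" "\<And>\<eta>. \<eta> \<in> E \<Longrightarrow> is_flow (\<phi> \<eta>) (\<Phi> \<eta>)"
      "\<phi> 0 = lorenz_field" "C1_continuous_family E \<phi>"
    and trapping_region:
      "open U" "\<And>\<eta> t. \<eta> \<in> E \<Longrightarrow> t \<ge> 0 \<Longrightarrow> \<Phi> \<eta> t ` U \<subseteq> U"
      "\<exists>A. is_attractor (\<Phi> 0) A \<and> A \<subseteq> U"
      "\<And>\<eta>. \<eta> \<in> E \<Longrightarrow> maximal_invariant (\<Phi> \<eta>) U \<subseteq> U"
      "\<And>\<eta>. \<eta> \<in> E \<Longrightarrow> flow_invariant (\<Phi> \<eta>) (maximal_invariant (\<Phi> \<eta>) U)"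
      "\<And>\<eta>. \<eta> \<in> E \<Longrightarrow> flow_transitive (\<Phi> \<eta>) (maximal_invariant (\<Phi> \<eta>) U)"
      "\<And>\<eta>. \<eta> \<in> E \<Longrightarrow> \<sigma> \<eta> \<in> maximal_invariant (\<Phi> \<eta>) U \<and> hyperbolic_singularity (\<phi> \<eta>) (\<sigma> \<eta>)"
    and cross_section:
      "M \<subseteq> U" "\<And>\<eta>. \<eta> \<in> E \<Longrightarrow> \<rho> \<eta> > 0 \<and> M \<inter> ball (\<sigma> \<eta>) (\<rho> \<eta>) = {}"
      "\<Gamma> = (\<lambda>\<eta>. singular_leaf (\<Phi> \<eta>) M (\<sigma> \<eta>) (\<rho> \<eta>))"
      "\<And>\<eta>. \<eta> \<in> E \<Longrightarrow> poincare_section (\<phi> \<eta>) (\<Phi> \<eta>) M (\<Gamma> \<eta>)"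
      "\<tau> = (\<lambda>\<eta>. return_time (\<Phi> \<eta>) M)" "R = (\<lambda>\<eta>. return_map (\<Phi> \<eta>) M)"
    and foliation:
      "I = (\<lambda>\<eta>. path_image (\<gamma> \<eta>))"
      "\<And>\<eta>. \<eta> \<in> E \<Longrightarrow> stable_foliation (R \<eta>) M (\<Gamma> \<eta>) (\<gamma> \<eta>) (q \<eta>)"
      "\<And>\<eta>. \<eta> \<in> E \<Longrightarrow> \<exists>u \<in> I \<eta>. \<Gamma> \<eta> = {x \<in> M. q \<eta> x = u}"
      "\<And>\<eta> x. \<eta> \<in> E \<Longrightarrow> x \<in> M - \<Gamma> \<eta> \<Longrightarrow> q \<eta> (R \<eta> x) = T \<eta> (q \<eta> x)"
    and conjugacies:
      "\<And>\<eta>. \<eta> \<in> E \<Longrightarrow> C1_diffeo M M (\<kappa> \<eta>)" "\<And>\<eta>. \<eta> \<in> E \<Longrightarrow> C1_diffeo (I \<eta>) (I 0) (\<iota> \<eta>)"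
      "\<And>\<eta> x. \<eta> \<in> E \<Longrightarrow> x \<in> M \<Longrightarrow> \<iota> \<eta> (q \<eta> x) = q 0 (\<kappa> \<eta> x)"
      "Rbar = (\<lambda>\<eta>. \<kappa> \<eta> \<circ> R \<eta> \<circ> inv_into M (\<kappa> \<eta>))"
      "Tbar = (\<lambda>\<eta>. \<iota> \<eta> \<circ> T \<eta> \<circ> inv_into (I \<eta>) (\<iota> \<eta>))"
      "rand_K \<kappa> \<in> restrict_space borel (M \<times> seqs E) \<rightarrow>\<^sub>M restrict_space borel (M \<times> seqs E)"
      "inv_into (M \<times> seqs E) (rand_K \<kappa>)
         \<in> restrict_space borel (M \<times> seqs E) \<rightarrow>\<^sub>M restrict_space borel (M \<times> seqs E)"
    and base_measure:
      "\<And>\<epsilon>. \<epsilon> \<in> {0<..<\<epsilon>\<^sub>0} \<Longrightarrow>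
         prob_space (\<mu>T \<epsilon>) \<and> sets (\<mu>T \<epsilon>) = sets (restrict_space borel (I 0 \<times> seqs E))"
      "\<And>\<epsilon>. \<epsilon> \<in> {0<..<\<epsilon>\<^sub>0} \<Longrightarrow>
         invariant_measure (\<mu>T \<epsilon>) (skew_dom (I 0) E (\<lambda>\<eta>. \<iota> \<eta> ` q \<eta> ` \<Gamma> \<eta>)) (skew Tbar)"
      "\<And>\<epsilon>. \<epsilon> \<in> {0<..<\<epsilon>\<^sub>0} \<Longrightarrow>
         distr (\<mu>T \<epsilon>) (Pi\<^sub>M UNIV (\<lambda>_. borel)) snd = Pi\<^sub>M UNIV (\<lambda>_. law \<epsilon>)"
    and return_measure:
      "\<And>\<epsilon>. \<epsilon> \<in> {0<..<\<epsilon>\<^sub>0} \<Longrightarrow>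
         fibre_inf_lift (\<mu>T \<epsilon>) (M \<times> seqs E) (\<lambda>(x, \<omega>). (q 0 x, \<omega>))
           (skew_dom M E (\<lambda>\<eta>. \<kappa> \<eta> ` \<Gamma> \<eta>)) (skew Rbar) (\<mu>Rbar \<epsilon>)"
      "\<mu>R = (\<lambda>\<epsilon>. distr (\<mu>Rbar \<epsilon>) (restrict_space borel (M \<times> seqs E))
                   (inv_into (M \<times> seqs E) (rand_K \<kappa>)))"
    and roof_function:
      "\<exists>c>0. \<forall>p \<in> skew_dom M E \<Gamma>. c \<le> roof \<Phi> M p"
      "\<And>\<epsilon>. \<epsilon> \<in> {0<..<\<epsilon>\<^sub>0} \<Longrightarrow> integrable (\<mu>R \<epsilon>) (roof \<Phi> M)"
    and suspension_measure:
      "\<mu>S = (\<lambda>\<epsilon>. distr (susp_measure (\<mu>R \<epsilon>) (roof \<Phi> M)) (borel_of (\<VV>_topology \<Phi> M E \<Gamma>))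
                   (\<VV>_proj \<Phi> M E \<Gamma>))"
    and flow_measure:
      "\<mu>V = (\<lambda>\<epsilon>. distr (\<mu>S \<epsilon>) (restrict_space borel (U \<times> \<Omega>)) (rand_V \<Phi>))"
    and unperturbed:
      "prob_space \<mu>T0" "sets \<mu>T0 = sets (restrict_space borel (I 0))"
      "absolutely_continuous (arclength_measure (\<gamma> 0)) \<mu>T0"
      "invariant_measure \<mu>T0 (I 0 - q 0 ` \<Gamma> 0) (T 0)"
      "fibre_inf_lift \<mu>T0 M (q 0) (M - \<Gamma> 0) (R 0) \<mu>R0"
      "integrable \<mu>R0 (\<tau> 0)"
      "\<mu>S0 = susp_measure \<mu>R0 (\<tau> 0)"
      "\<mu>0 = distr \<mu>S0 (restrict_space borel U) (\<lambda>(x, s). \<Phi> 0 s x)"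
    and stable: "stochastically_stable \<Phi> M E \<Gamma> \<mu>S \<mu>R0"
  shows "weak_limit (top_of_set (U \<times> \<Omega>)) \<mu>V
           (\<mu>0 \<Otimes>\<^sub>M return (restrict_space borel \<Omega>) zero_noise) (at_right 0)"
proof -
  obtain c where "0 < c" and c: "\<And>p. p \<in> skew_dom M E \<Gamma> \<Longrightarrow> c \<le> roof \<Phi> M p"
    using roof_function(1) by blast
  interpret random_suspension E \<phi> \<Phi> r M \<Gamma> \<sigma> \<rho> c U
  proof
    show "1 \<le> r"
      using fields(1) by simp
    show "Ck_on r UNIV (\<phi> \<eta>)" "is_flow (\<phi> \<eta>) (\<Phi> \<eta>)" if "\<eta> \<in> E" for \<eta>
      using fields(2,3) that by auto
    show "C1_continuous_family E \<phi>" "0 \<in> E" "E \<subseteq> {-1..1}" "M \<subseteq> U" "0 < c"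
      by fact+
    show "poincare_section (\<phi> \<eta>) (\<Phi> \<eta>) M (\<Gamma> \<eta>)" "\<Gamma> \<eta> = singular_leaf (\<Phi> \<eta>) M (\<sigma> \<eta>) (\<rho> \<eta>)"
      "M \<inter> ball (\<sigma> \<eta>) (\<rho> \<eta>) = {}" if "\<eta> \<in> E" for \<eta>
      using cross_section(2,3,4) that by auto
    show "\<Phi> \<eta> t ` U \<subseteq> U" if "\<eta> \<in> E" "0 \<le> t" for \<eta> t
      using trapping_region(2) that by blast
    \<comment> \<open>every parameter occurs as the first coordinate of a constant noise sequence\<close>
    show "c \<le> return_time (\<Phi> \<eta>) M x" if "\<eta> \<in> E" "x \<in> M - \<Gamma> \<eta>" for \<eta> x
      using c[of "(x, \<lambda>_. \<eta>)"] that by (auto simp: skew_dom_def seqs_def roof_def)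
  qed
  have small: "\<forall>\<^sub>F \<epsilon> in at_right 0. \<epsilon> \<in> {0<..<\<epsilon>\<^sub>0}"
    using noise_law(1) by (rule eventually_at_right_real)
  have sets_\<mu>S: "sets (\<mu>S \<epsilon>) = sets (borel_of (\<VV>_topology \<Phi> M E \<Gamma>))" for \<epsilon>
    by (simp add: suspension_measure)
  have finite_\<mu>S: "finite_measure (\<mu>S \<epsilon>)" if "\<epsilon> \<in> {0<..<\<epsilon>\<^sub>0}" for \<epsilon>
  proof (rule finite_measureI)
    interpret N: finite_measure "susp_measure (\<mu>R \<epsilon>) (roof \<Phi> M)"
      using roof_function(2)[OF that] by (rule finite_susp_measure)
    have "emeasure (\<mu>S \<epsilon>) (space (\<mu>S \<epsilon>))
        \<le> emeasure (susp_measure (\<mu>R \<epsilon>) (roof \<Phi> M)) (space (susp_measure (\<mu>R \<epsilon>) (roof \<Phi> M)))"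
      unfolding suspension_measure by (rule emeasure_distr_le)
    then show "emeasure (\<mu>S \<epsilon>) (space (\<mu>S \<epsilon>)) \<noteq> \<infinity>"
      using N.emeasure_finite top.extremum_uniqueI by fastforce
  qed
  have \<mu>S: "\<forall>\<^sub>F \<epsilon> in at_right 0. finite_measure (\<mu>S \<epsilon>) \<and>
      sets (\<mu>S \<epsilon>) = sets (borel_of (\<VV>_topology \<Phi> M E \<Gamma>))"
    using small by eventually_elim (simp add: finite_\<mu>S sets_\<mu>S)
  have \<mu>R0: "prob_space \<mu>R0" "sets \<mu>R0 = sets (restrict_space borel M)"
    using unperturbed(5) by (auto simp: fibre_inf_lift_def)
  have \<tau>0: "integrable \<mu>R0 (return_time (\<Phi> 0) M)"
    using unperturbed(6) by (simp add: cross_section(5))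
  have \<mu>S0: "\<mu>S0 = susp_measure \<mu>R0 (return_time (\<Phi> 0) M)"
    using unperturbed(7) by (simp add: cross_section(5))
  have space_\<mu>R0: "space \<mu>R0 = M"
    using sets_eq_imp_space_eq[OF \<mu>R0(2)] by (simp add: space_restrict_space)
  have space_\<mu>S0: "space \<mu>S0 = M \<times> {0..}"
    using sets_eq_imp_space_eq[OF sets_susp_measure, of \<mu>R0 "return_time (\<Phi> 0) M"]
    by (simp add: \<mu>S0 space_\<mu>R0 space_pair_measure space_restrict_space)
  have flow0: "(\<lambda>(x, s). \<Phi> 0 s x) \<in> \<mu>S0 \<rightarrow>\<^sub>M restrict_space borel U"
  proof (rule measurable_restrict_space2)
    show "(\<lambda>(x, s). \<Phi> 0 s x) \<in> space \<mu>S0 \<rightarrow> U"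
      using trapping_region(2)[OF noise_law(2)] cross_section(1) by (auto simp: space_\<mu>S0)
    have "continuous_on (M \<times> {0..}) (\<lambda>z. case (0, snd z, fst z) of (\<eta>, t, x) \<Rightarrow> \<Phi> \<eta> t x)"
      by (rule continuous_on_compose2[OF continuous_on_flow]) (use zero_in_E in \<open>auto intro!: continuous_intros\<close>)
    then have "continuous_on (M \<times> {0..}) (\<lambda>(x, s). \<Phi> 0 s x)"
      by (simp add: case_prod_unfold)
    from borel_measurable_continuous_on_Times_halfline[OF this \<mu>R0(2)]
    show "(\<lambda>(x, s). \<Phi> 0 s x) \<in> borel_measurable \<mu>S0"
      by (simp add: \<mu>S0 measurable_cong_sets[OF sets_susp_measure refl])
  qed
  have finite_\<mu>0: "finite_measure \<mu>0"
    unfolding unperturbed(8) using finite_susp_measure[OF \<tau>0] flow0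
    by (simp add: \<mu>S0 finite_measure.finite_measure_distr)
  show ?thesis
    unfolding weak_limit_def
  proof (intro allI impI)
    fix f assume "bounded_continuous (top_of_set (U \<times> \<Omega>)) f"
    then have f: "continuous_on (U \<times> \<Omega>) f" and "bounded (f ` (U \<times> \<Omega>))"
      by (auto simp: bounded_continuous_def)
    then obtain C where "\<forall>y\<in>f ` (U \<times> \<Omega>). norm y \<le> C"
      by (auto simp: bounded_iff)
    then have C: "\<And>y. y \<in> U \<times> \<Omega> \<Longrightarrow> \<bar>f y\<bar> \<le> C"
      by (metis imageI real_norm_def)
    have "(\<integral>y. f y \<partial>\<mu>V \<epsilon>) = (\<integral>z. f (rand_V \<Phi> z) \<partial>\<mu>S \<epsilon>)" for \<epsilon>
      unfolding flow_measure using rand_V_measurable[OF sets_\<mu>S]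
      by (rule integral_distr) (rule borel_measurable_continuous_on_restrict[OF f])
    moreover have "(\<integral>y. f y \<partial>(\<mu>0 \<Otimes>\<^sub>M return (restrict_space borel \<Omega>) zero_noise))
        = (\<integral>(x, s). f (\<Phi> 0 s x, zero_noise) \<partial>\<mu>S0)"
    proof -
      have "zero_noise \<in> \<Omega>"
        by (simp add: seqs_def zero_noise_def)
      then have "(\<integral>y. f y \<partial>(\<mu>0 \<Otimes>\<^sub>M return (restrict_space borel \<Omega>) zero_noise)) = (\<integral>y. f (y, zero_noise) \<partial>\<mu>0)"
        using finite_\<mu>0 f C by (intro integral_pair_return[where A = U]) (auto simp: unperturbed(8))
      also have "\<dots> = (\<integral>z. f ((case z of (x, s) \<Rightarrow> \<Phi> 0 s x), zero_noise) \<partial>\<mu>S0)"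
        unfolding unperturbed(8)
      proof (rule integral_distr[OF flow0])
        show "(\<lambda>y. f (y, zero_noise)) \<in> borel_measurable (restrict_space borel U)"
          using \<open>zero_noise \<in> \<Omega>\<close>
          by (intro borel_measurable_continuous_on_restrict continuous_on_compose2[OF f])
            (auto intro!: continuous_intros)
      qed
      finally show ?thesis
        by (simp add: case_prod_unfold)
    qed
    ultimately show "((\<lambda>\<epsilon>. \<integral>y. f y \<partial>\<mu>V \<epsilon>) \<longlongrightarrow>
        (\<integral>y. f y \<partial>(\<mu>0 \<Otimes>\<^sub>M return (restrict_space borel \<Omega>) zero_noise))) (at_right 0)"
      using weak_limit_of_flow[OF stable \<mu>R0 \<tau>0 \<mu>S f C] by (simp add: \<mu>S0)
  qed
qed

end
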